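(* Let $(\omega,c)\in\mathbb{R}^2$ satisfy: $\omega>c^2/4$, or $\omega=c^2/4$ and $c>0$. Then $$\lim_{L\to\infty}\bigl\|\Phi^L_{\omega,c}-\Phi_{\omega,c}\bigr\|_{H^m([-L,L])}=0\qquad\text{for } m=0,1,2.$$
   Context: Set $\alpha_0=\tfrac13(4c+\sqrt{48\omega+4c^2})$, $\alpha_1=4\sqrt\omega+2c$, $A(x)=-3x^2+8cx+64\omega$, $L_0(\omega,c)=2\pi/\sqrt{\alpha_0\sqrt{A(\alpha_0)}}$. For $\eta_3\in(\alpha_0,\alpha_1)$ put $\eta_1=\frac{-\eta_3+4c-\sqrt{A(\eta_3)}}{2}$, $\eta_2=\frac{-\eta_3+4c+\sqrt{A(\eta_3)}}{2}$, $k^2=\frac{-\eta_1(\eta_3-\eta_2)}{\eta_3(\eta_2-\eta_1)}\in(0,1)$, $g=\frac{2}{\sqrt{\eta_3(\eta_2-\eta_1)}}$, $\beta^2=-\eta_3k^2/\eta_1$, $T(\eta_3)=4gK(k)$ with $K(k)=\int_0^{\pi/2}(1-k^2\sin^2\theta)^{-1/2}d\theta$. The map $T$ is a strictly increasing bijection of $(\alpha_0,\alpha_1)$ onto $(2L_0,\infty)$; for $L>L_0$ let $\eta_3$ satisfy $T(\eta_3)=2L$, and let $\Phi^L_{\omega,c}>0$ on $[-L,L]$ be given by $(\Phi^L_{\omega,c}(x))^2=\eta_3\,\mathrm{dn}^2(\frac{x}{2g};k)/(1+\beta^2\mathrm{sn}^2(\frac{x}{2g};k))$ ($\mathrm{sn},\mathrm{dn}$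 Jacobi elliptic functions of modulus $k$). $\Phi_{\omega,c}>0$ on $\mathbb{R}$ is given by $\Phi_{\omega,c}^2(x)=\frac{4\omega-c^2}{\sqrt\omega(\cosh(\sqrt{4\omega-c^2}x)-\frac{c}{2\sqrt\omega})}$ if $\omega>c^2/4$, and $\Phi_{\omega,c}^2(x)=\frac{4c}{(cx)^2+1}$ if $\omega=c^2/4,\ c>0$. $H^m([-L,L])$ is the standard Sobolev space on the interval ($H^0=L^2$). *)

theory Defs
  imports "HOL-Analysis.Analysis"
begin

definition ellF :: "real \<Rightarrow> real \<Rightarrow> real" where
  "ellF ksq \<phi> = (if 0 \<le> \<phi> then integral {0..\<phi>} (\<lambda>\<theta>. 1 / sqrt (1 - ksq * (sin \<theta>)^2))
                 else - integral {\<phi>..0} (\<lambda>\<theta>. 1 / sqrt (1 - ksq * (sin \<theta>)^2)))"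

definition ellK :: "real \<Rightarrow> real" where
  "ellK ksq = integral {0..pi/2} (\<lambda>\<theta>. 1 / sqrt (1 - ksq * (sin \<theta>)^2))"

definition jam :: "real \<Rightarrow> real \<Rightarrow> real" where
  "jam ksq u = (THE \<phi>. ellF ksq \<phi> = u)"

definition jsn :: "real \<Rightarrow> real \<Rightarrow> real" where
  "jsn ksq u = sin (jam ksq u)"

definition jdn :: "real \<Rightarrow> real \<Rightarrow> real" where
  "jdn ksq u = sqrt (1 - ksq * (jsn ksq u)^2)"

definition alpha0 :: "real \<Rightarrow> real \<Rightarrow> real" where
  "alpha0 \<omega> c = (4*c + sqrt (48*\<omega> + 4*c^2)) / 3"

definition alpha1 :: "real \<Rightarrow> real \<Rightarrow> real" where
  "alpha1 \<omega> c = 4 * sqrt \<omega> + 2*c"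

definition Apoly :: "real \<Rightarrow> real \<Rightarrow> real \<Rightarrow> real" where
  "Apoly \<omega> c x = -3*x^2 + 8*c*x + 64*\<omega>"

definition eta1 :: "real \<Rightarrow> real \<Rightarrow> real \<Rightarrow> real" where
  "eta1 \<omega> c e3 = (- e3 + 4*c - sqrt (Apoly \<omega> c e3)) / 2"

definition eta2 :: "real \<Rightarrow> real \<Rightarrow> real \<Rightarrow> real" where
  "eta2 \<omega> c e3 = (- e3 + 4*c + sqrt (Apoly \<omega> c e3)) / 2"

definition ksqr :: "real \<Rightarrow> real \<Rightarrow> real \<Rightarrow> real" where
  "ksqr \<omega> c e3 = (- eta1 \<omega> c e3 * (e3 - eta2 \<omega> c e3)) / (e3 * (eta2 \<omega> c e3 - eta1 \<omega> c e3))"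

definition gfun :: "real \<Rightarrow> real \<Rightarrow> real \<Rightarrow> real" where
  "gfun \<omega> c e3 = 2 / sqrt (e3 * (eta2 \<omega> c e3 - eta1 \<omega> c e3))"

definition betasq :: "real \<Rightarrow> real \<Rightarrow> real \<Rightarrow> real" where
  "betasq \<omega> c e3 = - e3 * ksqr \<omega> c e3 / eta1 \<omega> c e3"

definition Tper :: "real \<Rightarrow> real \<Rightarrow> real \<Rightarrow> real" where
  "Tper \<omega> c e3 = 4 * gfun \<omega> c e3 * ellK (ksqr \<omega> c e3)"

definition eta3L :: "real \<Rightarrow> real \<Rightarrow> real \<Rightarrow> real" where
  "eta3L \<omega> c L = (THE e. alpha0 \<omega> c < e \<and> e < alpha1 \<omega> c \<and> Tper \<omega> c e = 2 * L)"

definition PhiL :: "real \<Rightarrow> real \<Rightarrow> real \<Rightarrow> real \<Rightarrow> real" where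
  "PhiL \<omega> c L x = (let e3 = eta3L \<omega> c L; k2 = ksqr \<omega> c e3; g = gfun \<omega> c e3;
       b2 = betasq \<omega> c e3 in
     sqrt (e3 * (jdn k2 (x / (2*g)))^2 / (1 + b2 * (jsn k2 (x / (2*g)))^2)))"

definition Phi :: "real \<Rightarrow> real \<Rightarrow> real \<Rightarrow> real" where
  "Phi \<omega> c x = (if \<omega> > c^2/4 then
       sqrt ((4*\<omega> - c^2) / (sqrt \<omega> * (cosh (sqrt (4*\<omega> - c^2) * x) - c / (2 * sqrt \<omega>))))
     else sqrt (4*c / ((c*x)^2 + 1)))"

text \<open>H^m([-L,L]) norm for smooth functions: sqrt of sum_{j<=m} of the L^2 norms squared of the derivatives.\<close>
definition Hm_norm :: "nat \<Rightarrow> real \<Rightarrow> (real \<Rightarrow> real) \<Rightarrow> real" where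
  "Hm_norm m L f = sqrt (\<Sum>j\<le>m. integral {-L..L} (\<lambda>x. ((deriv ^^ j) f x)^2))"

end

theory Submission
  imports Defs
begin

text \<open>
  Both profiles are square roots of positive solutions \<open>y\<close> of
  \<open>y'^2 = y (y - z) (y - v) (e - y) / 4\<close> whose roots \<open>z \<le> 0 \<le> v < e\<close> have fixed first and second
  symmetric functions, so the square root \<open>u\<close> solves one and the same equation \<open>u'' = force u\<close> for all
  periods and for the soliton; the initial data at the crest are \<open>(sqrt e, 0)\<close>, and \<open>e = eta3\<close>
  converges to \<open>alpha1\<close>. Gronwall gives convergence up to second derivatives on \<open>[0, R]\<close>.
  On \<open>[R, L]\<close> all derivatives up to order two are dominated by \<open>u\<close>, and the mass there is at most
  \<open>4 u(R) / sqrt (e - u(R)^2)\<close>, uniformly in \<open>L\<close>.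

  That \<open>eta3\<close> is determined by the period rests on the strict monotonicity of the period:
  it is \<open>8\<close> times the integral of \<open>1 / sqrt (A cos^2 t + B sin^2 t)\<close> over \<open>[0, pi/2]\<close> with
  \<open>A = e (v - z)\<close> and \<open>B = v (e - z)\<close>, and both \<open>A + B\<close> and \<open>A B / (A + B)\<close> decrease along the family.
  It diverges at \<open>alpha1\<close> because \<open>B\<close> tends to \<open>0\<close> while \<open>A\<close> stays bounded.
\<close>

section \<open>The Jacobi amplitude\<close>

lemma one_minus_sin_sq_pos:
  fixes m t :: real
  assumes "m < 1"
  shows "0 < 1 - m * (sin t)\<^sup>2"
proof (cases "m \<le> 0")
  case True
  then show ?thesis
    by (smt (verit) mult_nonpos_nonneg zero_le_power2)
next
  case False
  then have "m * (sin t)\<^sup>2 \<le> m * 1"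
    by (intro mult_left_mono) (auto simp: abs_square_le_1)
  then show ?thesis using assms by simp
qed

context
  fixes m :: real
  assumes m0: "0 \<le> m" and m1: "m < 1"
begin

lemma continuous_on_ellF_integrand:
  "continuous_on S (\<lambda>\<theta>. 1 / sqrt (1 - m * (sin \<theta>)\<^sup>2))"
  using one_minus_sin_sq_pos[OF m1] by (intro continuous_intros) (smt (verit) real_sqrt_eq_zero_cancel_iff)

lemma ellF_minus: "ellF m (- x) = - ellF m x"
proof -
  define f where "f = (\<lambda>\<theta>. 1 / sqrt (1 - m * (sin \<theta>)\<^sup>2))"
  have "(\<lambda>\<theta>. f (- \<theta>)) = f" by (simp add: f_def)
  then have "integral {- b..0} f = integral {0..b} f" for b
    using Henstock_Kurzweil_Integration.integral_reflect_real[of b 0 f] by simp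
  from this[of x] this[of "- x"] show ?thesis
    by (auto simp: ellF_def simp flip: f_def)
qed

text \<open>Moving the base point from 0 to the left of \<open>x\<close> merges the two cases of
  \<open>ellF\<close> into one integral up to a constant, so the fundamental theorem applies across
  0 as well.\<close>

lemma ellF_has_real_derivative:
  "(ellF m has_real_derivative 1 / sqrt (1 - m * (sin x)\<^sup>2)) (at x)"
proof -
  let ?f = "\<lambda>\<theta>. 1 / sqrt (1 - m * (sin \<theta>)\<^sup>2)"
  define a where "a = \<bar>x\<bar> + 1"
  have int: "?f integrable_on {p..q}" for p q
    using continuous_on_ellF_integrand by (rule integrable_continuous_real)
  have eq: "integral {-a..t} ?f - integral {-a..0} ?f = ellF m t" if "t \<in> {-a<..<a}" for t
  proof (cases "0 \<le> t")
    case True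
    then have "integral {-a..0} ?f + integral {0..t} ?f = integral {-a..t} ?f"
      using that int by (intro Henstock_Kurzweil_Integration.integral_combine) auto
    then show ?thesis using True by (simp add: ellF_def)
  next
    case False
    then have "integral {-a..t} ?f + integral {t..0} ?f = integral {-a..0} ?f"
      using that int by (intro Henstock_Kurzweil_Integration.integral_combine) auto
    then show ?thesis using False by (simp add: ellF_def)
  qed
  have "((\<lambda>t. integral {-a..t} ?f) has_real_derivative ?f x) (at x within {-a..a})"
    using continuous_on_ellF_integrand by (rule integral_has_real_derivative) (auto simp: a_def)
  then have "((\<lambda>t. integral {-a..t} ?f) has_real_derivative ?f x) (at x)"
    by (subst (asm) at_within_interior) (auto simp: a_def)
  then have "((\<lambda>t. integral {-a..t} ?f - integral {-a..0} ?f) has_real_derivative ?f x) (at x)"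
    by (auto intro!: derivative_eq_intros)
  then show ?thesis
    by (rule has_field_derivative_transform_within_open[where S = "{-a<..<a}"])
       (use eq in \<open>simp_all, simp add: a_def, linarith\<close>)
qed

text \<open>The integrand is at least 1 because \<open>0 <= m\<close>. This growth yields
  injectivity and, with \<open>ellF m 0 = 0\<close>, surjectivity, which makes the definite
  description in \<open>jam\<close> meaningful.\<close>

lemma ellF_diff_ge:
  assumes "x \<le> y"
  shows "y - x \<le> ellF m y - ellF m x"
proof -
  have "1 \<le> 1 / sqrt (1 - m * (sin t)\<^sup>2)" for t
    using one_minus_sin_sq_pos[OF m1, of t] m0 by (simp add: le_divide_eq)
  then have "\<exists>d. ((\<lambda>t. ellF m t - t) has_real_derivative d) (at t) \<and> 0 \<le> d" for t
    by (intro exI[of _ "1 / sqrt (1 - m * (sin t)\<^sup>2) - 1"])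
       (auto intro!: derivative_eq_intros ellF_has_real_derivative)
  then show ?thesis
    using DERIV_nonneg_imp_nondecreasing[OF assms, of "\<lambda>t. ellF m t - t"] by auto
qed

lemma isCont_ellF: "isCont (ellF m) x"
  using ellF_has_real_derivative DERIV_isCont by blast

lemma inj_ellF: "inj (ellF m)"
  by (rule injI) (smt (verit) ellF_diff_ge)

lemma ellF_0: "ellF m 0 = 0"
  by (simp add: ellF_def)

lemma surj_ellF: "\<exists>x. ellF m x = u"
proof -
  have "ellF m (-\<bar>u\<bar>) \<le> u" "u \<le> ellF m \<bar>u\<bar>"
    using ellF_diff_ge[of 0 "\<bar>u\<bar>"] ellF_minus[of "\<bar>u\<bar>"] ellF_0 by auto
  then show ?thesis
    using IVT[of "ellF m" "-\<bar>u\<bar>" u "\<bar>u\<bar>"] isCont_ellF by auto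
qed

lemma jam_ellF: "jam m (ellF m x) = x"
  unfolding jam_def using inj_ellF by (auto simp: inj_def)

lemma ellF_jam: "ellF m (jam m u) = u"
  using surj_ellF[of u] jam_ellF by metis

lemma jam_0: "jam m 0 = 0"
  using jam_ellF[of 0] ellF_0 by simp

lemma jam_minus: "jam m (- u) = - jam m u"
  by (metis ellF_jam ellF_minus jam_ellF)

lemma jam_ellK: "jam m (ellK m) = pi / 2"
proof -
  have "ellF m (pi/2) = ellK m" by (simp add: ellF_def ellK_def)
  then show ?thesis using jam_ellF by metis
qed

lemma jam_strict_mono:
  assumes "u < v" shows "jam m u < jam m v"
  by (rule ccontr) (use ellF_diff_ge[of "jam m v" "jam m u"] assms ellF_jam in auto)

text \<open>Inverse function rule. The derivative is the delta amplitude dn, through which all later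
  derivatives of the wave are computed.\<close>

lemma jam_has_real_derivative:
  "(jam m has_real_derivative sqrt (1 - m * (sin (jam m u))\<^sup>2)) (at u)"
proof -
  have "(jam m has_real_derivative inverse (1 / sqrt (1 - m * (sin (jam m u))\<^sup>2))) (at u)"
  proof (rule DERIV_inverse_function[where f = "ellF m" and a = "u - 1" and b = "u + 1"])
    show "isCont (jam m) u"
      using isCont_inverse_function[of 1 "jam m u" "jam m" "ellF m"] jam_ellF isCont_ellF ellF_jam
      by auto
  qed (use ellF_has_real_derivative ellF_jam one_minus_sin_sq_pos[OF m1, of "jam m u"] in auto)
  then show ?thesis by simp
qed

end

section \<open>The roots of the quartic\<close>

text \<open>Both parameter regimes in one form: \<open>disc\<close> includes the boundary points
  \<open>c = 2 * sqrt \<omega>\<close> and \<open>c = - 2 * sqrt \<omega>\<close>, and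
  \<open>alpha1_pos\<close> excludes the second.\<close>

locale admissible =
  fixes \<omega> c :: real
  assumes disc: "c\<^sup>2 \<le> 4 * \<omega>" and alpha1_pos: "0 < alpha1 \<omega> c"
begin

lemma omega_pos: "0 < \<omega>"
proof (rule ccontr)
  assume "\<not> 0 < \<omega>"
  then have "c\<^sup>2 \<le> 0" "\<omega> \<le> 0" using disc by linarith+
  then have "c = 0" "\<omega> = 0" using disc by auto
  then show False using alpha1_pos by (simp add: alpha1_def)
qed

lemma c_le: "c \<le> 2 * sqrt \<omega>"
proof -
  have "c \<le> sqrt (4 * \<omega>)" using disc by (rule real_le_rsqrt)
  then show ?thesis by (simp add: real_sqrt_mult)
qed

lemma c_gt: "- 2 * sqrt \<omega> < c"
  using alpha1_pos by (simp add: alpha1_def)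

lemma sqrt_omega: "0 < sqrt \<omega>" "(sqrt \<omega>)\<^sup>2 = \<omega>"
  using omega_pos by auto

lemma alpha0_less_alpha1: "alpha0 \<omega> c < alpha1 \<omega> c"
proof -
  have "(12 * sqrt \<omega> + 2 * c)\<^sup>2 - (48 * \<omega> + 4 * c\<^sup>2) = 48 * sqrt \<omega> * (2 * sqrt \<omega> + c)"
    using sqrt_omega(2) by (simp add: power2_eq_square algebra_simps)
  moreover have "48 * sqrt \<omega> * (2 * sqrt \<omega> + c) > 0"
    using c_gt sqrt_omega by (intro mult_pos_pos) auto
  ultimately have "sqrt (48 * \<omega> + 4 * c\<^sup>2) < 12 * sqrt \<omega> + 2 * c"
    using c_gt sqrt_omega(1) by (intro real_less_lsqrt) linarith+
  then show ?thesis by (simp add: alpha0_def alpha1_def)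
qed

end

section \<open>Roots of the quartic: symmetric functions, signs and order\<close>

locale cnoidal = admissible +
  fixes e :: real
  assumes e_gt: "alpha0 \<omega> c < e" and e_less: "e < alpha1 \<omega> c"
begin

abbreviation "z \<equiv> eta1 \<omega> c e"
abbreviation "v \<equiv> eta2 \<omega> c e"

lemma three_e_gt: "sqrt (48 * \<omega> + 4 * c\<^sup>2) < 3 * e - 4 * c"
  using e_gt by (simp add: alpha0_def)

lemma e_pos: "0 < e"
proof -
  have "sqrt ((4 * c)\<^sup>2) \<le> sqrt (48 * \<omega> + 4 * c\<^sup>2)"
    using disc by (intro real_sqrt_le_mono) (simp add: power2_eq_square)
  then have "\<bar>4 * c\<bar> \<le> sqrt (48 * \<omega> + 4 * c\<^sup>2)" by (simp only: real_sqrt_abs)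
  then show ?thesis using three_e_gt by linarith
qed

text \<open>By \<open>eta_prod\<close> this quantity is \<open>- z * v\<close>, so its sign puts 0
  between \<open>z\<close> and \<open>v\<close>. The first factor vanishes exactly at
  \<open>e = alpha1\<close>.\<close>

lemma gap_pos: "0 < 16 * \<omega> - (e - 2 * c)\<^sup>2"
proof -
  have "16 * \<omega> - (e - 2 * c)\<^sup>2 = (4 * sqrt \<omega> + 2 * c - e) * (4 * sqrt \<omega> - 2 * c + e)"
    using sqrt_omega(2) by (simp add: power2_eq_square algebra_simps)
  also have "\<dots> > 0"
    using e_less c_le e_pos by (intro mult_pos_pos) (auto simp: alpha1_def)
  finally show ?thesis .
qed

text \<open>\<open>Apoly\<close> is the discriminant of the monic quadratic with roots
  \<open>z\<close> and \<open>v\<close>, whose sum is \<open>4 * c - e\<close> and whose product is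
  given in \<open>eta_prod\<close>.\<close>

lemma Apoly_eq: "Apoly \<omega> c e = (4 * c - e)\<^sup>2 + 4 * (16 * \<omega> - (e - 2 * c)\<^sup>2)"
  by (simp add: Apoly_def power2_eq_square algebra_simps)

lemma Apoly_pos: "0 < Apoly \<omega> c e"
  unfolding Apoly_eq using gap_pos by (simp add: add_nonneg_pos)

lemma eta_sum: "z + v + e = 4 * c"
  by (simp add: eta1_def eta2_def field_simps)

lemma eta_diff: "v - z = sqrt (Apoly \<omega> c e)"
  by (simp add: eta1_def eta2_def field_simps)

lemma eta_prod: "z * v = (e - 2 * c)\<^sup>2 - 16 * \<omega>"
proof -
  have "4 * (z * v) = (4 * c - e)\<^sup>2 - (sqrt (Apoly \<omega> c e))\<^sup>2"
    by (simp add: eta1_def eta2_def field_simps power2_eq_square)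
  also have "(sqrt (Apoly \<omega> c e))\<^sup>2 = Apoly \<omega> c e" using Apoly_pos by simp
  finally show ?thesis by (simp add: Apoly_eq)
qed

text \<open>Like the value in \<open>eta_sum\<close>, this one does not involve \<open>e\<close>.
  The two invariants fix the equation for the square root of the wave, so that all periods share
  it.\<close>

lemma eta_sigma2: "z * v + e * (z + v) = 4 * c\<^sup>2 - 16 * \<omega>"
proof -
  have "z + v = 4 * c - e" using eta_sum by simp
  then show ?thesis by (simp only: eta_prod) (simp add: power2_eq_square algebra_simps)
qed

lemma eta_less: "z < v" using eta_diff Apoly_pos by (metis diff_gt_0_iff_gt real_sqrt_gt_zero)

lemma eta1_neg: "z < 0" and eta2_pos: "0 < v"
proof -
  have "z * v < 0" using eta_prod gap_pos by simp
  then show "z < 0" "0 < v" using eta_less by (auto simp: mult_less_0_iff)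
qed

text \<open>By the formula for \<open>v\<close> the claim is
  \<open>sqrt (Apoly \<omega> c e) < 3 * e - 4 * c\<close>. Squaring turns it into
  \<open>e > alpha0\<close>; at \<open>alpha0\<close> the roots \<open>v\<close> and
  \<open>e\<close> would coincide.\<close>

lemma eta2_less: "v < e"
proof -
  have "Apoly \<omega> c e < (3 * e - 4 * c)\<^sup>2"
  proof -
    have "48 * \<omega> + 4 * c\<^sup>2 < (3 * e - 4 * c)\<^sup>2"
      using three_e_gt omega_pos
      by (smt (verit) real_sqrt_less_iff real_sqrt_abs real_sqrt_ge_zero zero_le_power2)
    then show ?thesis by (simp add: Apoly_def power2_eq_square algebra_simps)
  qed
  then have "sqrt (Apoly \<omega> c e) < 3 * e - 4 * c"
    using three_e_gt omega_pos by (intro real_less_lsqrt) (smt (verit) real_sqrt_ge_zero zero_le_power2)+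
  then show ?thesis by (simp add: eta2_def)
qed

text \<open>These signs make the polynomials in \<open>z\<close> that govern the period decrease as
  \<open>z\<close> grows.\<close>

lemma eta1_less_c: "z < 2 * c" "3 * z < 4 * c"
proof -
  have "2 * z < 4 * c" using eta_sum eta2_pos e_pos eta_less by linarith
  then show "z < 2 * c" "3 * z < 4 * c" using eta1_neg by linarith+
qed

lemma ksqr_pos: "0 < ksqr \<omega> c e" and ksqr_less_1: "ksqr \<omega> c e < 1"
  and one_minus_ksqr: "1 - ksqr \<omega> c e = v * (e - z) / (e * (v - z))"
proof -
  have pos: "0 < e * (v - z)" using e_pos eta_less by simp
  show "0 < ksqr \<omega> c e"
    unfolding ksqr_def using pos eta1_neg eta2_less by (intro divide_pos_pos[OF _ pos] mult_pos_pos) auto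
  show eq: "1 - ksqr \<omega> c e = v * (e - z) / (e * (v - z))"
    unfolding ksqr_def using e_pos eta_less by (simp add: divide_simps) (simp add: algebra_simps)
  have "0 < v * (e - z) / (e * (v - z))"
    using pos eta2_pos eta1_neg e_pos by (intro divide_pos_pos mult_pos_pos) auto
  then show "ksqr \<omega> c e < 1" using eq by simp
qed

lemma betasq_eq: "betasq \<omega> c e = (e - v) / (v - z)"
  unfolding betasq_def ksqr_def using e_pos eta_less eta1_neg by (simp add: divide_simps)

text \<open>Moving \<open>e * (v - z)\<close> under the root turns the radicand into a combination
  of the squared cosine and sine, whose coefficients are swapped by reflecting the interval.\<close>

lemma Tper_eq:
  "Tper \<omega> c e = 8 * integral {0..pi/2} (\<lambda>t. 1 / sqrt (e * (v - z) * (cos t)\<^sup>2 + v * (e - z) * (sin t)\<^sup>2))"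
proof -
  let ?a = "e * (v - z)"
  have pos: "0 < ?a" using e_pos eta_less by simp
  have "1 / sqrt (?a * (cos t)\<^sup>2 + v * (e - z) * (sin t)\<^sup>2)
      = 1 / sqrt ?a * (1 / sqrt (1 - ksqr \<omega> c e * (sin t)\<^sup>2))" for t
  proof -
    have k: "?a * (1 - ksqr \<omega> c e) = v * (e - z)" using one_minus_ksqr e_pos eta_less by simp
    have "?a * (1 - ksqr \<omega> c e * (sin t)\<^sup>2) = ?a * (1 - (sin t)\<^sup>2) + ?a * (1 - ksqr \<omega> c e) * (sin t)\<^sup>2"
      by (simp add: algebra_simps)
    also have "\<dots> = ?a * (cos t)\<^sup>2 + v * (e - z) * (sin t)\<^sup>2"
      unfolding k cos_squared_eq ..
    finally have "sqrt (?a * (cos t)\<^sup>2 + v * (e - z) * (sin t)\<^sup>2) = sqrt ?a * sqrt (1 - ksqr \<omega> c e * (sin t)\<^sup>2)"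
      by (metis real_sqrt_mult)
    then show ?thesis by simp
  qed
  then show ?thesis
    by (simp add: Tper_def gfun_def ellK_def mult.assoc flip: integral_mult_right)
qed

end

section \<open>Monotonicity of the period\<close>

text \<open>With \<open>A = a^2\<close> and \<open>B = b^2\<close> this is Gauss's integral, equal
  to \<open>pi / 2\<close> divided by the arithmetic-geometric mean of \<open>a\<close> and
  \<open>b\<close>.\<close>

definition quarter_integral :: "real \<Rightarrow> real \<Rightarrow> real" where
  "quarter_integral A B = integral {0..pi/2} (\<lambda>t. 1 / sqrt (A * (cos t)\<^sup>2 + B * (sin t)\<^sup>2))"

lemma quarter_form_pos:
  fixes A B t :: real
  assumes "0 < A" "0 < B"
  shows "0 < A * (cos t)\<^sup>2 + B * (sin t)\<^sup>2"
proof (cases "sin t = 0")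
  case True
  then have "(cos t)\<^sup>2 = 1" by (simp add: cos_squared_eq)
  then show ?thesis using True assms by simp
next
  case False
  then show ?thesis using assms by (intro add_nonneg_pos) auto
qed

lemma continuous_on_quarter:
  assumes "0 < A" "0 < B"
  shows "continuous_on S (\<lambda>t. 1 / sqrt (A * (cos t)\<^sup>2 + B * (sin t)\<^sup>2))"
  using quarter_form_pos[OF assms] by (intro continuous_intros) (smt (verit) real_sqrt_eq_zero_cancel_iff)

lemma quarter_integral_commute: "quarter_integral A B = quarter_integral B A"
proof -
  define f where "f = (\<lambda>t. 1 / sqrt (A * (cos t)\<^sup>2 + B * (sin t)\<^sup>2))"
  have "integral {0..pi/2} f = integral {- (pi/2)..- 0} (\<lambda>t. f (- t))"
    by (rule Henstock_Kurzweil_Integration.integral_reflect_real[symmetric])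
  also have "\<dots> = integral {0..pi/2} (\<lambda>t. f (pi/2 - t))"
    using integral_shift_Icc_real[of "-(pi/2)" 0 "\<lambda>t. f (pi/2 - t)" "pi/2"] by (simp add: o_def)
  also have "(\<lambda>t. f (pi/2 - t)) = (\<lambda>t. 1 / sqrt (B * (cos t)\<^sup>2 + A * (sin t)\<^sup>2))"
    by (simp add: f_def cos_diff sin_diff add.commute)
  finally show ?thesis by (simp add: quarter_integral_def f_def)
qed

text \<open>Only the sum and the product enter on the right. For the two reflected radicands the sum
  does not depend on \<open>t\<close>.\<close>

lemma inverse_sqrt_sum:
  fixes p q :: real
  assumes "0 < p" "0 < q"
  shows "1 / sqrt p + 1 / sqrt q = sqrt ((p + q) / (p * q) + 2 / sqrt (p * q))"
proof -
  have "(1 / sqrt p + 1 / sqrt q)\<^sup>2 = (p + q) / (p * q) + 2 / sqrt (p * q)"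
    using assms by (simp add: power2_sum power_divide real_sqrt_mult field_simps)
  then show ?thesis
    using assms by (intro real_sqrt_unique[symmetric]) auto
qed

text \<open>Averaging the integrand over the reflection \<open>t \<mapsto> pi/2 - t\<close> leaves an expression that is
  monotone in \<open>A + B\<close> and \<open>A * B / (A + B)\<close>; no monotonicity in \<open>A\<close> itself is needed.\<close>

lemma quarter_integral_strict_antimono:
  assumes pos: "0 < A" "0 < B" "0 < A'" "0 < B'"
    and sum: "A' + B' < A + B" and harm: "A' * B' / (A' + B') < A * B / (A + B)"
  shows "quarter_integral A B < quarter_integral A' B'"
proof -
  define p where "p A B t = A * (cos t)\<^sup>2 + B * (sin t)\<^sup>2" for A B t :: real
  define h where "h A B t = 1 / sqrt (p A B t) + 1 / sqrt (p B A t)" for A B t :: real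
  have cont: "continuous_on S (h A B)" if "0 < A" "0 < B" for S and A B :: real
    unfolding h_def p_def using that by (intro continuous_on_add continuous_on_quarter)
  have twice: "2 * quarter_integral A B = integral {0..pi/2} (h A B)" if "0 < A" "0 < B" for A B :: real
  proof -
    have "2 * quarter_integral A B = quarter_integral A B + quarter_integral B A"
      using quarter_integral_commute[of A B] by simp
    also have "\<dots> = integral {0..pi/2} (h A B)"
      unfolding quarter_integral_def h_def p_def using that
      by (intro Henstock_Kurzweil_Integration.integral_add[symmetric] integrable_continuous_real continuous_on_quarter)
    finally show ?thesis .
  qed
  \<comment> \<open>\<open>\<rho>\<close> is the product of the two reflected radicands divided by
    their sum \<open>A + B\<close>. It is linear in \<open>A + B\<close> and
    \<open>A * B / (A + B)\<close>, with nonnegative weights depending on \<open>t\<close>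
    only.\<close>
  define \<rho> where "\<rho> A B t = (A + B) * ((cos t)\<^sup>2 * (sin t)\<^sup>2) + A * B / (A + B) * ((cos t)\<^sup>2 - (sin t)\<^sup>2)\<^sup>2"
    for A B t :: real
  have h_eq: "h A B t = sqrt (1 / \<rho> A B t + 2 / sqrt ((A + B) * \<rho> A B t))"
    and rho_pos: "0 < \<rho> A B t" if "0 < A" "0 < B" for A B t :: real
  proof -
    have s: "p A B t + p B A t = A + B"
      by (simp add: p_def cos_squared_eq algebra_simps)
    have "p A B t * p B A t = A * B * ((cos t)\<^sup>2 - (sin t)\<^sup>2)\<^sup>2 + (A + B)\<^sup>2 * ((cos t)\<^sup>2 * (sin t)\<^sup>2)"
      by (simp add: p_def power2_eq_square algebra_simps)
    also have "\<dots> = (A + B) * \<rho> A B t"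
      using that by (simp add: \<rho>_def power2_eq_square field_simps)
    finally have pr: "p A B t * p B A t = (A + B) * \<rho> A B t" .
    have pp: "0 < p A B t" "0 < p B A t" using quarter_form_pos that by (auto simp: p_def)
    show "h A B t = sqrt (1 / \<rho> A B t + 2 / sqrt ((A + B) * \<rho> A B t))"
      unfolding h_def inverse_sqrt_sum[OF pp] s pr using that by simp
    have "0 < (A + B) * \<rho> A B t" using pp pr by (metis mult_pos_pos)
    then show "0 < \<rho> A B t" using that by (simp add: zero_less_mult_iff)
  qed
  have "h A B t < h A' B' t" for t
  proof -
    have rho: "\<rho> A' B' t < \<rho> A B t"
    \<comment> \<open>Where the first weight vanishes the second is 1 and \<open>harm\<close> gives
      strictness; elsewhere \<open>sum\<close> does.\<close>
    proof (cases "(cos t)\<^sup>2 * (sin t)\<^sup>2 = 0")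
      case True
      then have "((cos t)\<^sup>2 - (sin t)\<^sup>2)\<^sup>2 = 1" by (auto simp: cos_squared_eq)
      then show ?thesis using harm unfolding \<rho>_def True by simp
    next
      case False
      then have "(A' + B') * ((cos t)\<^sup>2 * (sin t)\<^sup>2) < (A + B) * ((cos t)\<^sup>2 * (sin t)\<^sup>2)"
        using sum by (intro mult_strict_right_mono) (auto simp: less_le)
      then show ?thesis unfolding \<rho>_def using harm
        by (intro add_less_le_mono mult_right_mono) auto
    qed
    have "(A' + B') * \<rho> A' B' t < (A + B) * \<rho> A B t"
      using rho sum pos rho_pos[of A' B' t] by (intro mult_strict_mono) auto
    then have "2 / sqrt ((A + B) * \<rho> A B t) < 2 / sqrt ((A' + B') * \<rho> A' B' t)"
      using pos rho_pos[of A' B' t] rho_pos[of A B t]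
      by (intro divide_strict_left_mono mult_pos_pos real_sqrt_less_mono real_sqrt_gt_zero add_pos_pos) auto
    moreover have "1 / \<rho> A B t < 1 / \<rho> A' B' t"
      using rho rho_pos[of A' B' t] pos by (intro divide_strict_left_mono mult_pos_pos) auto
    ultimately show ?thesis using pos by (simp add: h_eq)
  qed
  then have "integral {0..pi/2} (h A B) < integral {0..pi/2} (h A' B')"
    using pos pi_gt_zero by (intro integral_less_real cont) (auto simp: not_le)
  then show ?thesis using twice[of A B] twice[of A' B'] pos by linarith
qed

text \<open>For small \<open>B\<close> the radicand nearly vanishes at \<open>pi/2\<close>. Since
  \<open>cos t <= pi/2 - t\<close>, its root is at most \<open>M * (pi/2 - t) + sqrt B\<close>,
  whose reciprocal has the explicit logarithmic antiderivative \<open>G\<close>.\<close>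

lemma quarter_integral_ge_ln:
  assumes A: "0 < A" and B: "0 < B" and AM: "sqrt A \<le> M"
  shows "ln (M * (pi/2) / sqrt B) / M \<le> quarter_integral A B"
proof -
  have M: "0 < M" using A AM by (smt (verit) real_sqrt_gt_zero)
  have b: "0 < sqrt B" using B by simp
  define G where "G t = - ln (M * (pi/2 - t) + sqrt B) / M" for t
  have "((\<lambda>t. 1 / (M * (pi/2 - t) + sqrt B)) has_integral (G (pi/2) - G 0)) {0..pi/2}"
  proof (rule fundamental_theorem_of_calculus)
    fix t assume "t \<in> {0..pi/2}"
    then have "0 < M * (pi/2 - t) + sqrt B" using M b by (intro add_nonneg_pos) auto
    then show "(G has_vector_derivative 1 / (M * (pi/2 - t) + sqrt B)) (at t within {0..pi/2})"
      unfolding G_def has_real_derivative_iff_has_vector_derivative[symmetric]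
      using M by (auto intro!: derivative_eq_intros)
  qed simp
  moreover have "((\<lambda>t. 1 / sqrt (A * (cos t)\<^sup>2 + B * (sin t)\<^sup>2)) has_integral quarter_integral A B) {0..pi/2}"
    unfolding quarter_integral_def
    using continuous_on_quarter[OF A B] by (intro integrable_integral integrable_continuous_real)
  ultimately have "G (pi/2) - G 0 \<le> quarter_integral A B"
  proof (rule has_integral_le)
    fix t assume t: "t \<in> {0..pi/2}"
    have c0: "0 \<le> cos t" "0 \<le> sin t" using t by (auto intro: cos_ge_zero sin_ge_zero)
    have "cos t \<le> pi/2 - t" using t sin_x_le_x[of "pi/2 - t"] by (simp add: cos_sin_eq)
    then have "sqrt A * cos t \<le> M * (pi/2 - t)" using c0 AM A M by (intro mult_mono) auto
    moreover have "sqrt B * sin t \<le> sqrt B" using b by simp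
    moreover have "sqrt (A * (cos t)\<^sup>2 + B * (sin t)\<^sup>2) \<le> sqrt A * cos t + sqrt B * sin t"
      using c0 A B sqrt_add_le_add_sqrt[of "A * (cos t)\<^sup>2" "B * (sin t)\<^sup>2"]
      by (simp add: real_sqrt_mult)
    ultimately have "sqrt (A * (cos t)\<^sup>2 + B * (sin t)\<^sup>2) \<le> M * (pi/2 - t) + sqrt B" by linarith
    moreover have "0 < sqrt (A * (cos t)\<^sup>2 + B * (sin t)\<^sup>2)" using quarter_form_pos[OF A B] by simp
    ultimately show "1 / (M * (pi/2 - t) + sqrt B) \<le> 1 / sqrt (A * (cos t)\<^sup>2 + B * (sin t)\<^sup>2)"
      by (intro divide_left_mono mult_pos_pos) linarith+
  qed
  moreover have "ln (M * (pi/2) / sqrt B) / M \<le> G (pi/2) - G 0"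
  proof -
    have "G (pi/2) - G 0 = (ln (M * (pi/2) + sqrt B) - ln (sqrt B)) / M"
      by (simp add: G_def diff_divide_distrib)
    moreover have "ln (M * (pi/2)) \<le> ln (M * (pi/2) + sqrt B)"
      using M b by (subst ln_le_cancel_iff) (auto intro: add_pos_pos)
    moreover have "ln (M * (pi/2) / sqrt B) = ln (M * (pi/2)) - ln (sqrt B)"
      using M b by (subst ln_divide_pos) auto
    ultimately show ?thesis using M by (simp only:) (intro divide_right_mono, auto)
  qed
  ultimately show ?thesis by linarith
qed

section \<open>Sum and product of the two integral arguments as polynomials in the lowest
  root\<close>

context cnoidal
begin

lemma Tper_quarter: "Tper \<omega> c e = 8 * quarter_integral (e * (v - z)) (v * (e - z))"
  by (simp add: Tper_eq quarter_integral_def)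

lemma quarter_args_pos: "0 < e * (v - z)" "0 < v * (e - z)"
  using e_pos eta_less eta2_pos eta1_neg by auto

lemma quarter_args_sum: "e * (v - z) + v * (e - z) = 3 * (z\<^sup>2 - 4 * c * z) - 2 * (16 * \<omega> - 4 * c\<^sup>2)"
proof -
  have v: "v = 4 * c - z - e" and w: "16 * \<omega> = 4 * c\<^sup>2 - z * v - e * (z + v)"
    using eta_sum eta_sigma2 by auto
  show ?thesis unfolding right_diff_distrib w by (subst v)+ (simp add: power2_eq_square algebra_simps)
qed

text \<open>The factors are regrouped: \<open>e * v\<close> follows from the symmetric functions,
  and \<open>(v - z) * (e - z)\<close> is the derivative at \<open>z\<close> of the monic cubic with
  roots \<open>z\<close>, \<open>v\<close>, \<open>e\<close>.\<close>

lemma quarter_args_prod: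
  "e * (v - z) * (v * (e - z)) = (z\<^sup>2 - 4 * c * z - (16 * \<omega> - 4 * c\<^sup>2)) * (3 * z\<^sup>2 - 8 * c * z - (16 * \<omega> - 4 * c\<^sup>2))"
proof -
  have v: "v = 4 * c - z - e" using eta_sum by simp
  have d: "16 * \<omega> - 4 * c\<^sup>2 = - (z * v + e * (z + v))" using eta_sigma2 by simp
  have "e * v = z\<^sup>2 - 4 * c * z - (16 * \<omega> - 4 * c\<^sup>2)"
    unfolding d by (subst v)+ (simp add: power2_eq_square algebra_simps)
  moreover have "(v - z) * (e - z) = 3 * z\<^sup>2 - 8 * c * z - (16 * \<omega> - 4 * c\<^sup>2)"
    unfolding d by (subst v)+ (simp add: power2_eq_square algebra_simps)
  ultimately show ?thesis by (metis (no_types, lifting) mult.assoc mult.left_commute)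
qed

end

text \<open>The root \<open>z\<close> grows with \<open>e\<close>, and everything is expressed
  through \<open>z\<close>: the two arguments have sum \<open>3 * X - 2 * D\<close> and product
  \<open>(X - D) * Y\<close>, where \<open>X\<close> and \<open>Y\<close> decrease.\<close>

lemma (in admissible) Tper_strict_mono:
  assumes e: "alpha0 \<omega> c < e" and ee: "e < e'" and e': "e' < alpha1 \<omega> c"
  shows "Tper \<omega> c e < Tper \<omega> c e'"
proof -
  interpret E: cnoidal \<omega> c e using e ee e' by unfold_locales auto
  interpret E': cnoidal \<omega> c e' using e ee e' by unfold_locales auto
  define D where "D = 16 * \<omega> - 4 * c\<^sup>2"
  define X where "X = E.z\<^sup>2 - 4 * c * E.z"
  define X' where "X' = E'.z\<^sup>2 - 4 * c * E'.z"
  define Y where "Y = 3 * E.z\<^sup>2 - 8 * c * E.z - D"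
  define Y' where "Y' = 3 * E'.z\<^sup>2 - 8 * c * E'.z - D"
  have D: "0 \<le> D" using disc by (simp add: D_def)
  \<comment> \<open>The cubics with roots \<open>z, v, e\<close> and \<open>z', v', e'\<close>
    differ by a constant. Comparing their difference at \<open>e'\<close> and at \<open>z\<close>
    and cancelling \<open>e' - z\<close> gives this identity.\<close>
  have "(e' - e) * (e' - E.v) = (E'.z - E.z) * (E'.v - E.z)"
    using E.eta_sum E'.eta_sum E.eta_sigma2 E'.eta_sigma2 by algebra
  moreover have "0 < (e' - e) * (e' - E.v)" using ee E.eta2_less by simp
  ultimately have z: "E.z < E'.z"
    using E.eta1_neg E'.eta2_pos by (simp add: zero_less_mult_iff)
  have "X - X' = (E'.z - E.z) * (4 * c - E.z - E'.z)"
    by (simp add: X_def X'_def power2_eq_square algebra_simps)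
  also have "\<dots> > 0" using z E.eta1_less_c(1) E'.eta1_less_c(1) by (intro mult_pos_pos) auto
  finally have X: "X' < X" by simp
  have "Y - Y' = (E'.z - E.z) * (8 * c - 3 * E.z - 3 * E'.z)"
    by (simp add: Y_def Y'_def power2_eq_square algebra_simps)
  also have "\<dots> > 0" using z E.eta1_less_c(2) E'.eta1_less_c(2) by (intro mult_pos_pos) auto
  finally have Y: "Y' < Y" by simp
  have sum: "e * (E.v - E.z) + E.v * (e - E.z) = 3 * X - 2 * D"
    and sum': "e' * (E'.v - E'.z) + E'.v * (e' - E'.z) = 3 * X' - 2 * D"
    by (simp_all add: E.quarter_args_sum E'.quarter_args_sum X_def X'_def D_def)
  have prod: "e * (E.v - E.z) * (E.v * (e - E.z)) = (X - D) * Y"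
    and prod': "e' * (E'.v - E'.z) * (E'.v * (e' - E'.z)) = (X' - D) * Y'"
    by (simp_all add: E.quarter_args_prod E'.quarter_args_prod X_def X'_def Y_def Y'_def D_def)
  have m': "0 < 3 * X' - 2 * D" using E'.quarter_args_pos sum' by linarith
  have Y'0: "0 < Y'" and XD': "0 < X' - D"
  proof -
    have "Y' = (E'.v - E'.z) * (e' - E'.z)" "X' - D = e' * E'.v"
      unfolding Y'_def X'_def D_def using E'.eta_sum E'.eta_sigma2 by algebra+
    then show "0 < Y'" "0 < X' - D"
      using E'.eta_less E'.eta1_neg E'.e_pos E'.eta2_pos by auto
  qed
  \<comment> \<open>The quotient is nondecreasing in \<open>X\<close> because \<open>0 <= D\<close>;
    the factor \<open>Y\<close> then supplies strictness.\<close>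
  have "(X' - D) / (3 * X' - 2 * D) \<le> (X - D) / (3 * X - 2 * D)"
  proof -
    have "D * X' \<le> D * X" using D X by (intro mult_left_mono) auto
    then show ?thesis using m' X by (simp add: divide_simps) (simp add: algebra_simps)
  qed
  then have "(X' - D) / (3 * X' - 2 * D) * Y' < (X - D) / (3 * X - 2 * D) * Y"
    using Y Y'0 m' XD' by (intro mult_le_less_imp_less) auto
  then have "quarter_integral (e * (E.v - E.z)) (E.v * (e - E.z))
      < quarter_integral (e' * (E'.v - E'.z)) (E'.v * (e' - E'.z))"
    using E.quarter_args_pos E'.quarter_args_pos X
    by (intro quarter_integral_strict_antimono) (auto simp: sum sum' prod prod')
  then show ?thesis by (simp add: E.Tper_quarter E'.Tper_quarter)
qed

section \<open>The crest value determined by the period\<close>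

context admissible
begin

lemma cnoidalI: "alpha0 \<omega> c < e \<Longrightarrow> e < alpha1 \<omega> c \<Longrightarrow> cnoidal \<omega> c e"
  by unfold_locales

lemma continuous_on_Tper: "continuous_on {alpha0 \<omega> c<..<alpha1 \<omega> c} (Tper \<omega> c)"
proof -
  let ?I = "{alpha0 \<omega> c<..<alpha1 \<omega> c}"
  have cn: "cnoidal \<omega> c e" if "e \<in> ?I" for e using that by (auto intro: cnoidalI)
  have A: "continuous_on ?I (Apoly \<omega> c)" unfolding Apoly_def by (intro continuous_intros)
  have z: "continuous_on ?I (eta1 \<omega> c)" and v: "continuous_on ?I (eta2 \<omega> c)"
    unfolding eta1_def eta2_def by (intro continuous_intros A; simp)+
  have ne: "e * (eta2 \<omega> c e - eta1 \<omega> c e) \<noteq> 0" if "e \<in> ?I" for e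
    using cnoidal.quarter_args_pos(1)[OF cn[OF that]] by (simp only: less_imp_neq[symmetric] not_False_eq_True)
  have k: "continuous_on ?I (ksqr \<omega> c)"
    unfolding ksqr_def using ne by (intro continuous_intros z v) auto
  have g: "continuous_on ?I (gfun \<omega> c)"
    unfolding gfun_def using ne by (intro continuous_intros z v) auto
  have "continuous_on (?I \<times> cbox 0 (pi/2)) (\<lambda>(e, t). 1 / sqrt (1 - ksqr \<omega> c e * (sin t)\<^sup>2))"
  proof -
    have "continuous_on (?I \<times> cbox 0 (pi/2)) (\<lambda>p. ksqr \<omega> c (fst p))"
      by (rule continuous_on_compose2[OF k]) (auto intro!: continuous_intros)
    moreover have "1 - ksqr \<omega> c (fst p) * (sin (snd p))\<^sup>2 \<noteq> 0" if "p \<in> ?I \<times> cbox 0 (pi/2)" for p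
      using one_minus_sin_sq_pos[OF cnoidal.ksqr_less_1[OF cn, of "fst p"], of "snd p"] that by auto
    ultimately show ?thesis
      unfolding case_prod_unfold by (intro continuous_intros) auto
  qed
  then have "continuous_on ?I (\<lambda>e. ellK (ksqr \<omega> c e))"
    unfolding ellK_def by (intro integral_continuous_on_param[where a = 0 and b = "pi/2", simplified]) simp
  then show ?thesis unfolding Tper_def by (intro continuous_intros g)
qed

text \<open>At \<open>alpha1\<close> the discriminant is a perfect square and the middle root
  reaches 0. The second argument of \<open>quarter_integral\<close> vanishes with it, which makes
  the period diverge.\<close>

lemma eta2_alpha1: "eta2 \<omega> c (alpha1 \<omega> c) = 0"
proof -
  have "Apoly \<omega> c (alpha1 \<omega> c) = (4 * sqrt \<omega> - 2 * c)\<^sup>2"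
    using sqrt_omega(2) by (simp add: Apoly_def alpha1_def power2_eq_square algebra_simps)
  then have "sqrt (Apoly \<omega> c (alpha1 \<omega> c)) = 4 * sqrt \<omega> - 2 * c" using c_le by simp
  then show ?thesis by (simp add: eta2_def alpha1_def)
qed

lemma Tper_unbounded:
  assumes "e0 < alpha1 \<omega> c"
  shows "\<exists>e. e0 < e \<and> alpha0 \<omega> c < e \<and> e < alpha1 \<omega> c \<and> H < Tper \<omega> c e"
proof -
  \<comment> \<open>A bound for \<open>sqrt (e * (v - z))\<close> on the whole range, from
    \<open>e < alpha1\<close> and \<open>c * e <= \<bar>c\<bar> * alpha1\<close>; the summand 1
    makes it positive.\<close>
  define M where "M = sqrt (alpha1 \<omega> c * sqrt (64 * \<omega> + 8 * \<bar>c\<bar> * alpha1 \<omega> c)) + 1"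
  define B where "B e = eta2 \<omega> c e * (e - eta1 \<omega> c e)" for e
  have M: "0 < M" unfolding M_def using alpha1_pos omega_pos by (intro add_nonneg_pos) auto
  \<comment> \<open>Solves \<open>8 * ln (M * (pi/2) / \<delta>) / M = H\<close>, so
    \<open>sqrt (B e) < \<delta>\<close> lifts the logarithmic lower bound above
    \<open>H\<close>.\<close>
  define \<delta> where "\<delta> = M * (pi/2) * exp (- (H * M / 8))"
  have \<delta>: "0 < \<delta>" using M by (simp add: \<delta>_def)
  have "isCont B (alpha1 \<omega> c)"
    unfolding B_def eta1_def eta2_def Apoly_def by (intro continuous_intros) simp_all
  then have "(B \<longlongrightarrow> 0) (at_left (alpha1 \<omega> c))"
    by (metis B_def eta2_alpha1 filterlim_at_split isCont_def mult_zero_left)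
  then have "\<forall>\<^sub>F e in at_left (alpha1 \<omega> c). B e < \<delta>\<^sup>2"
    using \<delta> by (intro order_tendstoD) auto
  moreover have "\<forall>\<^sub>F e in at_left (alpha1 \<omega> c). e \<in> {max e0 (alpha0 \<omega> c)<..<alpha1 \<omega> c}"
    using assms alpha0_less_alpha1 by (intro eventually_at_leftI[of "max e0 (alpha0 \<omega> c)"]) auto
  ultimately have "\<forall>\<^sub>F e in at_left (alpha1 \<omega> c). B e < \<delta>\<^sup>2 \<and> e \<in> {max e0 (alpha0 \<omega> c)<..<alpha1 \<omega> c}"
    by eventually_elim auto
  then obtain e where e: "B e < \<delta>\<^sup>2" "e0 < e" "alpha0 \<omega> c < e" "e < alpha1 \<omega> c"
    using eventually_happens'[OF trivial_limit_at_left_real] by force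
  interpret cnoidal \<omega> c e using e by (intro cnoidalI)
  have B: "0 < B e" using quarter_args_pos(2) by (simp add: B_def)
  have b: "sqrt (B e) < \<delta>" using e(1) \<delta> by (intro real_less_lsqrt) auto
  have "sqrt (e * (v - z)) \<le> M"
  proof -
    have "c * e \<le> \<bar>c\<bar> * alpha1 \<omega> c"
      using e_pos e_less by (intro mult_mono) auto
    then have "Apoly \<omega> c e \<le> 64 * \<omega> + 8 * \<bar>c\<bar> * alpha1 \<omega> c"
      using zero_le_power2[of e] unfolding Apoly_def by linarith
    then have "e * sqrt (Apoly \<omega> c e) \<le> alpha1 \<omega> c * sqrt (64 * \<omega> + 8 * \<bar>c\<bar> * alpha1 \<omega> c)"
      using e_pos e_less Apoly_pos by (intro mult_mono real_sqrt_le_mono) auto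
    then have "sqrt (e * sqrt (Apoly \<omega> c e)) \<le> sqrt (alpha1 \<omega> c * sqrt (64 * \<omega> + 8 * \<bar>c\<bar> * alpha1 \<omega> c))"
      by (rule real_sqrt_le_mono)
    then show ?thesis unfolding eta_diff M_def by linarith
  qed
  from quarter_integral_ge_ln[OF quarter_args_pos this]
  have "8 * (ln (M * (pi/2) / sqrt (B e)) / M) \<le> Tper \<omega> c e"
    by (simp add: Tper_quarter B_def)
  moreover have "H < 8 * (ln (M * (pi/2) / sqrt (B e)) / M)"
  proof -
    have "M * (pi/2) / \<delta> < M * (pi/2) / sqrt (B e)"
      using b B \<delta> M by (intro divide_strict_left_mono mult_pos_pos) auto
    moreover have "M * (pi/2) / \<delta> = exp (H * M / 8)"
      using M by (simp add: \<delta>_def exp_minus field_simps)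
    ultimately have "H * M / 8 < ln (M * (pi/2) / sqrt (B e))"
      by (metis exp_gt_zero less_trans ln_exp ln_less_cancel_iff)
    then show ?thesis using M by (simp add: field_simps)
  qed
  ultimately show ?thesis using e by (intro exI[of _ e]) auto
qed

text \<open>Strict monotonicity of the period gives the uniqueness that the definite description in
  \<open>eta3L\<close> asks for.\<close>

lemma eta3L_eqI:
  assumes "alpha0 \<omega> c < e" "e < alpha1 \<omega> c" "Tper \<omega> c e = 2 * L"
  shows "eta3L \<omega> c L = e"
  unfolding eta3L_def
proof (rule the_equality)
  fix e' assume "alpha0 \<omega> c < e' \<and> e' < alpha1 \<omega> c \<and> Tper \<omega> c e' = 2 * L"
  then show "e' = e"
    using assms Tper_strict_mono[of e e'] Tper_strict_mono[of e' e] by (cases e e' rule: linorder_cases) auto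
qed (use assms in auto)

text \<open>Once \<open>2 * L\<close> is at least the period at some \<open>e1 > e0\<close>, the
  intermediate value theorem finds a solution above \<open>e1\<close>, and uniqueness identifies it
  with \<open>eta3L\<close>. Taking \<open>e0\<close> close to \<open>alpha1\<close> yields the
  convergence.\<close>

lemma eventually_eta3L_gt:
  assumes "e0 < alpha1 \<omega> c"
  shows "\<forall>\<^sub>F L in at_top. e0 < eta3L \<omega> c L \<and> alpha0 \<omega> c < eta3L \<omega> c L \<and> eta3L \<omega> c L < alpha1 \<omega> c \<and>
     Tper \<omega> c (eta3L \<omega> c L) = 2 * L"
proof -
  obtain e1 where e1: "e0 < e1" "alpha0 \<omega> c < e1" "e1 < alpha1 \<omega> c"
    using Tper_unbounded[OF assms] by blast
  show ?thesis
    using eventually_ge_at_top[of "Tper \<omega> c e1 / 2"]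
  proof eventually_elim
    case (elim L)
    obtain e2 where e2: "e1 < e2" "e2 < alpha1 \<omega> c" "2 * L < Tper \<omega> c e2"
      using Tper_unbounded[OF e1(3), of "2 * L"] by blast
    have "continuous_on {e1..e2} (Tper \<omega> c)"
      using e1 e2 by (intro continuous_on_subset[OF continuous_on_Tper]) auto
    then obtain e where e: "e1 \<le> e" "e \<le> e2" "Tper \<omega> c e = 2 * L"
      using IVT'[of "Tper \<omega> c" e1 "2 * L" e2] elim e2 by auto
    then show ?case using eta3L_eqI[of e L] e1 e2 by auto
  qed
qed

lemma eta3L_tendsto: "(eta3L \<omega> c \<longlongrightarrow> alpha1 \<omega> c) at_top"
proof (rule order_tendstoI)
  fix a assume "a < alpha1 \<omega> c"
  from eventually_eta3L_gt[OF this] show "\<forall>\<^sub>F L in at_top. a < eta3L \<omega> c L"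
    by eventually_elim simp
next
  fix a assume a: "alpha1 \<omega> c < a"
  from eventually_eta3L_gt[OF alpha0_less_alpha1] show "\<forall>\<^sub>F L in at_top. eta3L \<omega> c L < a"
    by eventually_elim (use a in linarith)
qed

end

section \<open>Periodic profiles\<close>

text \<open>The second-order equation is demanded besides the first-order one, because dividing by
  \<open>y1\<close> fails at the crest. The weak signs of \<open>z\<close> and \<open>v\<close>
  admit the solitons, where \<open>v = 0\<close>, and also \<open>z = 0\<close> in the algebraic
  case. \<open>L\<close> is the half-period of a periodic wave and arbitrary for a soliton.\<close>

locale wave_profile =
  fixes \<omega> c z v e L :: real and y y1 :: "real \<Rightarrow> real"
  assumes y_pos: "0 < y x" and y_even: "y (- x) = y x"
    and y_deriv: "(y has_real_derivative y1 x) (at x)"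
    and y1_deriv: "(y1 has_real_derivative
      ((y x - z) * (y x - v) * (e - y x) + y x * (y x - v) * (e - y x)
        + y x * (y x - z) * (e - y x) - y x * (y x - z) * (y x - v)) / 8) (at x)"
    and energy: "(y1 x)\<^sup>2 = y x * (y x - z) * (y x - v) * (e - y x) / 4"
    and z_nonpos: "z \<le> 0" and v_nonneg: "0 \<le> v"
    and sigma1: "z + v + e = 4 * c" and sigma2: "z * v + e * (z + v) = 4 * c\<^sup>2 - 16 * \<omega>"
    and y_0: "y 0 = e"
    and decreasing: "0 < x \<Longrightarrow> x < L \<Longrightarrow> y1 x < 0" and above: "0 < x \<Longrightarrow> x < L \<Longrightarrow> v < y x"

section \<open>The squared cnoidal wave as a wave profile\<close>

context cnoidal
begin

abbreviation "k \<equiv> ksqr \<omega> c e"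
abbreviation "b \<equiv> betasq \<omega> c e"
abbreviation "amp x \<equiv> jam k (x / (2 * gfun \<omega> c e))"

definition prof :: "real \<Rightarrow> real" where
  "prof x = e * (1 - k * (sin (amp x))\<^sup>2) / (1 + b * (sin (amp x))\<^sup>2)"

definition prof1 :: "real \<Rightarrow> real" where
  "prof1 x = (z - e) * b * (sin (amp x) * cos (amp x) * sqrt (1 - k * (sin (amp x))\<^sup>2) / gfun \<omega> c e)
     / (1 + b * (sin (amp x))\<^sup>2)\<^sup>2"

lemma betasq_pos: "0 < b"
  using betasq_eq eta2_less eta_less by simp

lemma betasq_ksqr: "e * k = - z * b"
  using eta1_neg by (simp add: betasq_def)

lemma betasq_eta: "b * (v - z) = e - v"
  using eta_less by (simp add: betasq_eq)

lemma betasq_eta': "b * (e - z) = (b + 1) * (e - v)"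
  using betasq_eta by (simp add: algebra_simps)

lemma gfun_pos: "0 < gfun \<omega> c e"
  using quarter_args_pos by (simp add: gfun_def)

text \<open>Converts the horizontal scale \<open>gfun\<close> into the constant
  \<open>e * (e - v) / 4\<close> of the differential equation.\<close>

lemma gfun_betasq: "4 * b = e * (e - v) * (gfun \<omega> c e)\<^sup>2"
proof -
  have "(gfun \<omega> c e)\<^sup>2 = 4 / (e * (v - z))"
    using quarter_args_pos by (simp add: gfun_def power_divide)
  then show ?thesis using e_pos eta_less by (simp add: betasq_eq)
qed

lemma denom_pos: "0 < 1 + b * (sin t)\<^sup>2"
  using betasq_pos by (intro add_pos_nonneg) auto

lemma numer_pos: "0 < 1 - k * (sin t)\<^sup>2"
  using ksqr_less_1 by (rule one_minus_sin_sq_pos)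

lemma amp_deriv: "((\<lambda>x. amp x) has_real_derivative sqrt (1 - k * (sin (amp x))\<^sup>2) / (2 * gfun \<omega> c e)) (at x)"
proof -
  have "((\<lambda>x. x / (2 * gfun \<omega> c e)) has_real_derivative 1 / (2 * gfun \<omega> c e)) (at x)"
    using gfun_pos by (auto intro!: derivative_eq_intros)
  from DERIV_chain2[OF jam_has_real_derivative this] show ?thesis
    using ksqr_pos ksqr_less_1 by simp
qed

text \<open>In terms of \<open>w\<close> each linear factor of the quartic is \<open>N\<close> times
  a polynomial of degree at most one, so the differential equations become polynomial identities in
  \<open>w\<close>.\<close>

lemma prof_factors:
  fixes x :: real
  defines "w \<equiv> (sin (amp x))\<^sup>2" and "N \<equiv> 1 / (1 + b * (sin (amp x))\<^sup>2)"
  shows "prof x = e * (1 - k * w) * N" "prof x - z = (e - z) * N"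
    "prof x - v = (e - v) * (1 - w) * N" "e - prof x = (e - z) * b * w * N"
proof -
  have d: "1 + b * w \<noteq> 0" using denom_pos[of "amp x"] unfolding w_def by simp
  have N: "N * (1 + b * w) = 1" using d unfolding N_def w_def by simp
  show p: "prof x = e * (1 - k * w) * N" by (simp add: prof_def w_def N_def)
  show "prof x - z = (e - z) * N" "prof x - v = (e - v) * (1 - w) * N" "e - prof x = (e - z) * b * w * N"
    unfolding p using N betasq_ksqr betasq_eta by algebra+
qed

lemma prof_deriv: "(prof has_real_derivative prof1 x) (at x)"
proof -
  define D where "D = 1 + b * (sin (amp x))\<^sup>2"
  have D: "D \<noteq> 0" using denom_pos[of "amp x"] by (simp add: D_def)
  have eq: "prof = (\<lambda>x. z + (e - z) * inverse (1 + b * (sin (amp x))\<^sup>2))"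
  proof
    fix x show "prof x = z + (e - z) * inverse (1 + b * (sin (amp x))\<^sup>2)"
      using prof_factors(2)[of x] by (simp add: inverse_eq_divide)
  qed
  have "((\<lambda>x. 1 + b * (sin (amp x))\<^sup>2) has_real_derivative
      b * (sin (amp x) * cos (amp x) * sqrt (1 - k * (sin (amp x))\<^sup>2) / gfun \<omega> c e)) (at x)"
    by (rule derivative_eq_intros amp_deriv refl)+ simp
  from DERIV_inverse'[OF this] D
  have "((\<lambda>x. inverse (1 + b * (sin (amp x))\<^sup>2)) has_real_derivative
      - (inverse D * (b * (sin (amp x) * cos (amp x) * sqrt (1 - k * (sin (amp x))\<^sup>2) / gfun \<omega> c e)) * inverse D)) (at x)"
    by (simp add: D_def)
  from DERIV_cmult[OF this, of "e - z"]
  have "(prof has_real_derivative (e - z) * - (inverse D *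
      (b * (sin (amp x) * cos (amp x) * sqrt (1 - k * (sin (amp x))\<^sup>2) / gfun \<omega> c e)) * inverse D)) (at x)"
    unfolding eq by (rule DERIV_cong[OF DERIV_add[OF DERIV_const]]) simp_all
  moreover have "(e - z) * - (inverse D * (b * R) * inverse D) = (z - e) * b * R / D\<^sup>2" for R
    by (simp add: divide_inverse power2_eq_square algebra_simps)
  ultimately show ?thesis
    by (simp only: prof1_def D_def)
qed

text \<open>Both sides are \<open>N ^ 3\<close> times a polynomial in \<open>w\<close>: the product
  \<open>P\<close> of sine, cosine and dn enters only through its square and its derivative, and
  both are polynomials in \<open>w\<close>.\<close>

lemma prof1_deriv: "(prof1 has_real_derivative
      ((prof x - z) * (prof x - v) * (e - prof x) + prof x * (prof x - v) * (e - prof x)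
        + prof x * (prof x - z) * (e - prof x) - prof x * (prof x - z) * (prof x - v)) / 8) (at x)"
proof -
  define g where "g = gfun \<omega> c e"
  define S where "S = sin (amp x)"
  define Cc where "Cc = cos (amp x)"
  define \<Delta> where "\<Delta> = sqrt (1 - k * S\<^sup>2)"
  define w where "w = S\<^sup>2"
  define N where "N = 1 / (1 + b * w)"
  have g: "0 < g" using gfun_pos by (simp add: g_def)
  have \<Delta>: "0 < \<Delta>" "\<Delta>\<^sup>2 = 1 - k * w" using numer_pos[of "amp x"] by (auto simp: \<Delta>_def S_def w_def)
  have C: "Cc\<^sup>2 = 1 - w" by (simp add: Cc_def w_def S_def cos_squared_eq)
  have D: "0 < 1 + b * w" using denom_pos by (simp add: w_def S_def)
  have ampd: "((\<lambda>x. amp x) has_real_derivative \<Delta> / (2 * g)) (at x)"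
    using amp_deriv[of x] by (simp add: \<Delta>_def S_def g_def)
  have \<Delta>d: "((\<lambda>x. sqrt (1 - k * (sin (amp x))\<^sup>2)) has_real_derivative - (k * S * Cc) / (2 * g)) (at x)"
    using \<Delta>(1) g by (auto intro!: derivative_eq_intros ampd simp: S_def[symmetric] Cc_def[symmetric] \<Delta>_def[symmetric])
      (use numer_pos[of "amp x"] \<Delta> g in \<open>auto simp: S_def[symmetric] Cc_def[symmetric] \<Delta>_def[symmetric] field_simps\<close>)
  define P where "P = (\<lambda>x. sin (amp x) * cos (amp x) * sqrt (1 - k * (sin (amp x))\<^sup>2))"
  have Pd: "(P has_real_derivative ((1 - 2 * w) * (1 - k * w) - k * w * (1 - w)) / (2 * g)) (at x)"
  proof -
    have "(P has_real_derivative ((Cc * (\<Delta> / (2 * g)) * Cc + - S * (\<Delta> / (2 * g)) * S) * \<Delta> + - (k * S * Cc) / (2 * g) * (S * Cc))) (at x)"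
      unfolding P_def
      by (rule derivative_eq_intros ampd \<Delta>d refl)+ (simp add: S_def Cc_def \<Delta>_def algebra_simps)
    moreover have "(Cc * (\<Delta> / (2 * g)) * Cc + - S * (\<Delta> / (2 * g)) * S) * \<Delta> + - (k * S * Cc) / (2 * g) * (S * Cc)
      = ((Cc\<^sup>2 - S\<^sup>2) * \<Delta>\<^sup>2 - k * S\<^sup>2 * Cc\<^sup>2) / (2 * g)"
      using g by (simp add: field_simps power2_eq_square)
    ultimately show ?thesis by (simp only: C \<Delta>(2) w_def[symmetric]) (simp add: algebra_simps)
  qed
  define Q where "Q = (\<lambda>x. 1 + b * (sin (amp x))\<^sup>2)"
  have Qd: "(Q has_real_derivative b * P x / g) (at x)"
    unfolding Q_def using g by (auto intro!: derivative_eq_intros ampd simp: P_def S_def Cc_def \<Delta>_def)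
  have Qx: "Q x = 1 + b * w" and Px: "(P x)\<^sup>2 = w * (1 - w) * (1 - k * w)"
    using numer_pos[of "amp x"]
    by (simp_all add: Q_def w_def S_def P_def power_mult_distrib cos_squared_eq less_imp_le)
  let ?d = "- (e - z) * b / g * ((((1 - 2 * w) * (1 - k * w) - k * w * (1 - w)) / (2 * g)) * (Q x)\<^sup>2 - P x * (2 * Q x * (b * P x / g))) / ((Q x)\<^sup>2)\<^sup>2"
  have "((\<lambda>x. - (e - z) * b / g * (P x / (Q x)\<^sup>2)) has_real_derivative ?d) (at x)"
  proof -
    have "((\<lambda>x. (Q x)\<^sup>2) has_real_derivative 2 * Q x * (b * P x / g)) (at x)"
      by (auto intro!: derivative_eq_intros Qd)
    from DERIV_cmult[OF DERIV_divide[OF Pd this], of "- (e - z) * b / g"] show ?thesis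
      using D Qx by (simp only: power2_eq_square[of "(Q x)\<^sup>2"] times_divide_eq_right) simp
  qed
  moreover have "prof1 = (\<lambda>x. - (e - z) * b / g * (P x / (Q x)\<^sup>2))"
    by (simp add: fun_eq_iff prof1_def P_def Q_def g_def)
  moreover have "?d = ((prof x - z) * (prof x - v) * (e - prof x) + prof x * (prof x - v) * (e - prof x)
        + prof x * (prof x - z) * (e - prof x) - prof x * (prof x - z) * (prof x - v)) / 8"
    (is "_ = ?r")
  proof -
    \<comment> \<open>The numerator left by the quotient rule after cancelling one factor
      \<open>Q x\<close>.\<close>
    define J where "J = ((1 - 2 * w) * (1 - k * w) - k * w * (1 - w)) * (1 + b * w) - 4 * b * (w * (1 - w) * (1 - k * w))"
    have N: "N * Q x = 1" using D by (simp add: N_def Qx)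
    have "?d = - (e - z) * (b / (2 * g\<^sup>2)) * J * N ^ 3"
    proof -
      have "?d = - (e - z) * b / g * ((((1 - 2 * w) * (1 - k * w) - k * w * (1 - w)) / (2 * g)) * Q x - 2 * b * (P x)\<^sup>2 / g) / (Q x) ^ 3"
        using D g Qx by (simp add: divide_simps power2_eq_square power3_eq_cube) (simp add: algebra_simps)
      also have "\<dots> = - (e - z) * (b / (2 * g\<^sup>2)) * J * N ^ 3"
        unfolding Px J_def N_def Qx using D g by (simp add: divide_simps power2_eq_square power3_eq_cube)
      finally show ?thesis .
    qed
    also have "b / (2 * g\<^sup>2) = e * (e - v) / 8"
      using gfun_betasq g by (simp add: g_def[symmetric] field_simps)
    finally have l: "?d = - (e - z) * (e * (e - v) / 8) * J * N ^ 3" .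
    have pf: "prof x = e * (1 - k * w) * N" "prof x - z = (e - z) * N"
      "prof x - v = (e - v) * (1 - w) * N" "e - prof x = (e - z) * b * w * N"
      using prof_factors[of x] by (simp_all add: w_def S_def N_def)
    have cube: "(y2 * N * (y3 * N) * (y4 * N) + y1 * N * (y3 * N) * (y4 * N) + y1 * N * (y2 * N) * (y4 * N)
        - y1 * N * (y2 * N) * (y3 * N)) / 8
      = N ^ 3 / 8 * (y2 * y3 * y4 + y1 * y3 * y4 + y1 * y2 * y4 - y1 * y2 * y3)" for y1 y2 y3 y4 :: real
      by (simp add: power3_eq_cube field_simps)
    \<comment> \<open>Two forms of \<open>(e - z) * b\<close>: the suitable choice in each term
      makes \<open>e * (e - v)\<close> a common factor, and what remains is
      \<open>- J\<close>.\<close>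
    have b1: "(e - z) * b = (b + 1) * (e - v)" and b2: "(e - z) * b = e * (b + k)"
      using betasq_eta' betasq_ksqr by (simp_all add: algebra_simps)
    have J: "- J = (1 - w) * w * (b + k) + (1 - k * w) * (1 - w) * b * w
        + (1 - k * w) * w * (b + 1) - (1 - k * w) * (1 - w)"
      unfolding J_def by (simp add: algebra_simps)
    have "?r = N ^ 3 / 8 * ((e - z) * ((e - v) * (1 - w)) * ((e - z) * b * w)
        + e * (1 - k * w) * ((e - v) * (1 - w)) * ((e - z) * b * w)
        + e * (1 - k * w) * (e - z) * ((e - z) * b * w) - e * (1 - k * w) * (e - z) * ((e - v) * (1 - w)))"
      unfolding pf(2,3,4) unfolding pf(1) by (rule cube)
    also have "\<dots> = N ^ 3 / 8 * (e - z) * ((e - v) * (1 - w) * w * ((e - z) * b)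
        + e * (1 - k * w) * (e - v) * (1 - w) * b * w
        + e * (1 - k * w) * w * ((e - z) * b) - e * (1 - k * w) * (e - v) * (1 - w))"
      by (simp only: ring_distribs mult_ac)
    also have "\<dots> = N ^ 3 / 8 * (e - z) * ((e - v) * (1 - w) * w * (e * (b + k))
        + e * (1 - k * w) * (e - v) * (1 - w) * b * w
        + e * (1 - k * w) * w * ((b + 1) * (e - v)) - e * (1 - k * w) * (e - v) * (1 - w))"
      by (simp only: b1[symmetric] b2[symmetric])
    also have "\<dots> = N ^ 3 / 8 * (e - z) * (e * (e - v) * (- J))"
      unfolding J by (simp only: ring_distribs mult_ac)
    also have "\<dots> = - (e - z) * (e * (e - v) / 8) * J * N ^ 3" by (simp add: algebra_simps)
    finally show ?thesis using l by simp
  qed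
  ultimately show ?thesis by (simp only:)
qed

lemma prof_energy: "(prof1 x)\<^sup>2 = prof x * (prof x - z) * (prof x - v) * (e - prof x) / 4"
proof -
  define g where "g = gfun \<omega> c e"
  define w where "w = (sin (amp x))\<^sup>2"
  define N where "N = 1 / (1 + b * (sin (amp x))\<^sup>2)"
  have g: "0 < g" using gfun_pos by (simp add: g_def)
  have "prof1 x = (z - e) * b / g * (sin (amp x) * cos (amp x) * sqrt (1 - k * w)) * N\<^sup>2"
    by (simp add: prof1_def w_def N_def g_def power_divide)
  then have "(prof1 x)\<^sup>2 = (e - z)\<^sup>2 * b * (b / g\<^sup>2) * (w * (1 - w) * (1 - k * w)) * N ^ 4"
    using numer_pos[of "amp x"]
    by (simp add: power_mult_distrib power_divide w_def cos_squared_eq less_imp_le power2_eq_square[of b]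
        power2_commute[of z e])
  also have "b / g\<^sup>2 = e * (e - v) / 4"
    using gfun_betasq g by (simp add: g_def[symmetric] field_simps)
  also have "(e - z)\<^sup>2 * b * (e * (e - v) / 4) * (w * (1 - w) * (1 - k * w)) * N ^ 4
     = (e * (1 - k * w) * N) * ((e - z) * N) * ((e - v) * (1 - w) * N) * ((e - z) * b * w * N) / 4"
    by (simp add: power2_eq_square power4_eq_xxxx)
  finally show ?thesis using prof_factors[of x] by (simp add: w_def N_def)
qed

lemma wave_profile_prof:
  assumes "Tper \<omega> c e = 2 * L"
  shows "wave_profile \<omega> c z v e L prof prof1"
proof
  fix x
  show "0 < prof x"
    unfolding prof_def using e_pos numer_pos denom_pos by (intro divide_pos_pos mult_pos_pos) auto
  have "amp (- x) = - amp x" using jam_minus[of k "x / (2 * gfun \<omega> c e)"] ksqr_pos ksqr_less_1 by simp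
  then show "prof (- x) = prof x" by (simp add: prof_def)
next
  show "prof 0 = e" using jam_0[of k] ksqr_pos ksqr_less_1 by (simp add: prof_def)
next
  fix x assume x: "0 < x" "x < L"
  \<comment> \<open>The half-period is \<open>L = 2 * gfun \<omega> c e * ellK k\<close>, so before
    it the amplitude stays in the first quadrant.\<close>
  have "x / (2 * gfun \<omega> c e) < ellK k"
    using x assms gfun_pos by (simp add: Tper_def field_simps)
  then have "amp x < pi / 2" "0 < amp x"
    using jam_strict_mono[of k _ "ellK k"] jam_strict_mono[of k 0] jam_ellK[of k] jam_0[of k] ksqr_pos ksqr_less_1 x gfun_pos
    by force+
  then have sc: "0 < sin (amp x)" "0 < cos (amp x)"
    by (auto intro: sin_gt_zero cos_gt_zero simp: pi_gt_zero order.strict_trans)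
  show "prof1 x < 0"
  proof -
    have "0 < (e - z) * b * (sin (amp x) * cos (amp x) * sqrt (1 - k * (sin (amp x))\<^sup>2) / gfun \<omega> c e)
     / (1 + b * (sin (amp x))\<^sup>2)\<^sup>2"
      using sc numer_pos[of "amp x"] gfun_pos denom_pos[of "amp x"] betasq_pos e_pos eta1_neg
      by (intro divide_pos_pos mult_pos_pos) auto
    moreover have "prof1 x = - ((e - z) * b * (sin (amp x) * cos (amp x) * sqrt (1 - k * (sin (amp x))\<^sup>2) / gfun \<omega> c e)
     / (1 + b * (sin (amp x))\<^sup>2)\<^sup>2)"
      unfolding prof1_def minus_divide_left mult_minus_left[symmetric] minus_diff_eq ..
    ultimately show ?thesis by simp
  qed
  have "0 < prof x - v"
    unfolding prof_factors(3) using sc eta2_less denom_pos[of "amp x"]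
    by (intro mult_pos_pos) (auto simp: cos_squared_eq[symmetric])
  then show "v < prof x" by simp
qed (use prof_deriv prof1_deriv prof_energy eta1_neg eta2_pos eta_sum eta_sigma2 in auto)

end

lemma (in admissible) PhiL_eq_sqrt_prof:
  assumes "alpha0 \<omega> c < eta3L \<omega> c L" "eta3L \<omega> c L < alpha1 \<omega> c"
  shows "PhiL \<omega> c L x = sqrt (cnoidal.prof \<omega> c (eta3L \<omega> c L) x)"
proof -
  interpret cnoidal \<omega> c "eta3L \<omega> c L" using assms by unfold_locales
  show ?thesis
    using numer_pos by (simp add: PhiL_def Let_def jdn_def jsn_def prof_def less_imp_le)
qed

section \<open>Tail estimates\<close>

text \<open>The coefficients of \<open>u ^ 3\<close> and \<open>u\<close> are twice the sum of the
  roots and minus their second symmetric function, before division by 16.\<close>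

definition force :: "real \<Rightarrow> real \<Rightarrow> real \<Rightarrow> real" where
  "force \<omega> c u = (- 3 * u ^ 5 + 8 * c * u ^ 3 + (16 * \<omega> - 4 * c\<^sup>2) * u) / 16"

text \<open>Bounds the derivative of \<open>force\<close> on \<open>[0, sqrt M]\<close>; here
  \<open>M\<close> bounds \<open>y\<close>, the square of the argument.\<close>

definition force_lip :: "real \<Rightarrow> real \<Rightarrow> real \<Rightarrow> real" where
  "force_lip \<omega> c M = (15 * M\<^sup>2 + 24 * \<bar>c\<bar> * M + \<bar>16 * \<omega> - 4 * c\<^sup>2\<bar>) / 16"

lemma force_lip_nonneg: "0 \<le> M \<Longrightarrow> 0 \<le> force_lip \<omega> c M"
  by (simp add: force_lip_def)

lemma force_lipschitz:
  assumes "0 \<le> a" "a \<le> sqrt M" "0 \<le> b" "b \<le> sqrt M"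
  shows "\<bar>force \<omega> c a - force \<omega> c b\<bar> \<le> force_lip \<omega> c M * \<bar>a - b\<bar>"
proof -
  have M: "0 \<le> M" using assms by (metis order_trans real_sqrt_ge_0_iff)
  have "norm (force \<omega> c a - force \<omega> c b) \<le> force_lip \<omega> c M * norm (a - b)"
  proof (rule field_differentiable_bound[where S = "{0..sqrt M}"
        and f' = "\<lambda>t. (- 15 * t ^ 4 + 24 * c * t\<^sup>2 + (16 * \<omega> - 4 * c\<^sup>2)) / 16"])
    fix t assume t: "t \<in> {0..sqrt M}"
    show "(force \<omega> c has_field_derivative (- 15 * t ^ 4 + 24 * c * t\<^sup>2 + (16 * \<omega> - 4 * c\<^sup>2)) / 16) (at t within {0..sqrt M})"
      unfolding force_def by (auto intro!: derivative_eq_intros)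
    have "t\<^sup>2 \<le> (sqrt M)\<^sup>2" using t by (intro power_mono) auto
    then have t2: "t\<^sup>2 \<le> M" using M by simp
    then have "(t\<^sup>2)\<^sup>2 \<le> M\<^sup>2" by (intro power_mono) auto
    then have t4: "t ^ 4 \<le> M\<^sup>2" by simp
    have "\<bar>c * t\<^sup>2\<bar> \<le> \<bar>c\<bar> * M" using t2 by (simp add: abs_mult mult_left_mono)
    moreover have "0 \<le> t ^ 4" by simp
    ultimately have "\<bar>- 15 * t ^ 4 + 24 * (c * t\<^sup>2) + (16 * \<omega> - 4 * c\<^sup>2)\<bar>
        \<le> 15 * M\<^sup>2 + 24 * (\<bar>c\<bar> * M) + \<bar>16 * \<omega> - 4 * c\<^sup>2\<bar>"
      using t4 by linarith
    then show "norm ((- 15 * t ^ 4 + 24 * c * t\<^sup>2 + (16 * \<omega> - 4 * c\<^sup>2)) / 16) \<le> force_lip \<omega> c M"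
      unfolding force_lip_def real_norm_def by (simp add: mult.assoc)
  qed (use assms in auto)
  then show ?thesis by simp
qed

section \<open>The square root of a profile and its equation\<close>

context wave_profile
begin

definition u :: "real \<Rightarrow> real" where "u x = sqrt (y x)"
definition u1 :: "real \<Rightarrow> real" where "u1 x = y1 x / (2 * u x)"

lemma u_pos: "0 < u x" and u_sq: "(u x)\<^sup>2 = y x"
  using y_pos by (auto simp: u_def less_imp_le)

lemma u_deriv: "(u has_real_derivative u1 x) (at x)"
  unfolding u_def u1_def using y_pos[of x]
  by (auto intro!: derivative_eq_intros y_deriv simp: field_simps)

text \<open>With \<open>u = sqrt y\<close> one has
  \<open>u'' = (2 * y * y'' - y'^2) / (4 * u^3)\<close>. In the numerator the product
  \<open>z * v * e\<close> cancels, which leaves only the two shared symmetric functions.\<close>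

lemma u1_deriv: "(u1 has_real_derivative force \<omega> c (u x)) (at x)"
proof -
  define y2 where "y2 = ((y x - z) * (y x - v) * (e - y x) + y x * (y x - v) * (e - y x)
        + y x * (y x - z) * (e - y x) - y x * (y x - z) * (y x - v)) / 8"
  have "(u1 has_real_derivative (y2 * (2 * u x) - y1 x * (2 * u1 x)) / (2 * u x * (2 * u x))) (at x)"
    unfolding u1_def[abs_def] using u_pos[of x] unfolding y2_def
    by (intro DERIV_divide y1_deriv DERIV_cmult u_deriv[unfolded u1_def]) auto
  moreover have "(y2 * (2 * u x) - y1 x * (2 * u1 x)) / (2 * u x * (2 * u x)) = force \<omega> c (u x)"
  proof -
    have "(y2 * (2 * u x) - y1 x * (2 * u1 x)) / (2 * u x * (2 * u x)) = (2 * y2 * (u x)\<^sup>2 - (y1 x)\<^sup>2) / (4 * (u x) ^ 3)"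
      using u_pos[of x] by (simp add: u1_def divide_simps power2_eq_square power3_eq_cube)
    also have "2 * y2 * (u x)\<^sup>2 - (y1 x)\<^sup>2 = force \<omega> c (u x) * (4 * (u x) ^ 3)"
    proof -
      define D where "D = 16 * \<omega> - 4 * c\<^sup>2"
      have D: "z * v + e * (z + v) = - D" using sigma2 by (simp add: D_def)
      have "4 * (2 * y2 * y x - (y1 x)\<^sup>2) = y x * y x * (- 3 * (y x)\<^sup>2 + 2 * (z + v + e) * y x - (z * v + e * (z + v)))"
      proof -
        have "Y * ((Y - z) * (Y - v) * (e - Y) + Y * (Y - v) * (e - Y) + Y * (Y - z) * (e - Y) - Y * (Y - z) * (Y - v))
            - Y * (Y - z) * (Y - v) * (e - Y) = Y * Y * (- 3 * Y\<^sup>2 + 2 * (z + v + e) * Y - (z * v + e * (z + v)))" for Y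
          by (simp add: power2_eq_square algebra_simps)
        note this[of "y x"]
        moreover have "8 * y2 = (y x - z) * (y x - v) * (e - y x) + y x * (y x - v) * (e - y x)
            + y x * (y x - z) * (e - y x) - y x * (y x - z) * (y x - v)"
          by (simp add: y2_def)
        moreover have "4 * (y1 x)\<^sup>2 = y x * (y x - z) * (y x - v) * (e - y x)"
          by (simp add: energy)
        moreover have "4 * (2 * y2 * y x - (y1 x)\<^sup>2) = y x * (8 * y2) - 4 * (y1 x)\<^sup>2"
          by (simp add: right_diff_distrib)
        ultimately show ?thesis by (simp only:)
      qed
      also have "\<dots> = y x * y x * (- 3 * (y x)\<^sup>2 + 8 * c * y x + D)" unfolding sigma1 D by simp
      also have "\<dots> = 4 * (force \<omega> c (u x) * (4 * (u x) ^ 3))"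
      proof -
        have "U\<^sup>2 * U\<^sup>2 * (- 3 * (U\<^sup>2)\<^sup>2 + 8 * c * U\<^sup>2 + D) = (- 3 * U ^ 5 + 8 * c * U ^ 3 + D * U) * U ^ 3" for U :: real
          by (simp add: eval_nat_numeral ring_distribs mult_ac)
        from this[of "u x"] have "y x * y x * (- 3 * (y x)\<^sup>2 + 8 * c * y x + D)
            = (- 3 * u x ^ 5 + 8 * c * u x ^ 3 + D * u x) * u x ^ 3" by (simp only: u_sq)
        also have "\<dots> = 4 * ((- 3 * u x ^ 5 + 8 * c * u x ^ 3 + D * u x) / 16 * (4 * u x ^ 3))"
          by simp
        finally show ?thesis unfolding force_def D_def .
      qed
      finally show ?thesis by (simp add: u_sq)
    qed
    finally show ?thesis using u_pos[of x] by simp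
  qed
  ultimately show ?thesis by simp
qed

lemma u1_sq: "(u1 x)\<^sup>2 = (y x - z) * (y x - v) * (e - y x) / 16"
proof -
  have "(u1 x)\<^sup>2 = (y1 x)\<^sup>2 / (4 * y x)" by (simp add: u1_def power_divide power_mult_distrib u_sq)
  also have "\<dots> = (y x - z) * (y x - v) * (e - y x) / 16" using y_pos[of x] unfolding energy by simp
  finally show ?thesis .
qed

lemma u_even: "u (- x) = u x" by (simp add: u_def y_even)

lemma u1_odd: "u1 (- x) = - u1 x"
proof -
  have "((\<lambda>x. u (- x)) has_real_derivative - u1 (- x)) (at x)"
    using u_deriv[of "- x"] DERIV_mirror by blast
  then have "(u has_real_derivative - u1 (- x)) (at x)" by (simp only: u_even)
  from DERIV_unique[OF u_deriv this] show ?thesis by simp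
qed

lemma continuous_on_y: "continuous_on S y"
  using y_deriv by (intro continuous_at_imp_continuous_on ballI DERIV_isCont)

lemma y_antimono: "y b \<le> y a" if "0 \<le> a" "a \<le> b" "b \<le> L"
proof (rule DERIV_nonpos_imp_decreasing_open[OF that(2)])
  fix x assume "a < x" "x < b"
  then show "\<exists>d. (y has_real_derivative d) (at x) \<and> d \<le> 0"
    using y_deriv decreasing[of x] that by (intro exI[of _ "y1 x"]) auto
qed (rule continuous_on_y)

lemma y_le: "0 \<le> x \<Longrightarrow> x \<le> L \<Longrightarrow> y x \<le> e"
  using y_antimono[of 0 x] y_0 by simp

lemma e_pos: "0 < e" using y_pos[of 0] y_0 by simp

lemma y_less: "y x < e" if "0 < x" "x \<le> L"
proof -
  have "y x < y 0"
  proof (rule DERIV_neg_imp_decreasing_open[OF that(1)])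
    fix t assume "0 < t" "t < x"
    then show "\<exists>d. (y has_real_derivative d) (at t) \<and> d < 0"
      using y_deriv decreasing[of t] that by (intro exI[of _ "y1 t"]) auto
  qed (rule continuous_on_y)
  then show ?thesis using y_0 by simp
qed

text \<open>Since \<open>- (sqrt (y - v))' = sqrt (y * (y - z) * (e - y)) / 4\<close> dominates a multiple of \<open>y\<close>,
  the mass of the tail is controlled by the value at its left end, uniformly in the profile.\<close>

lemma tail_mass:
  assumes R: "0 < R" "R \<le> L"
  shows "integral {R..L} y \<le> 4 * u R / sqrt (e - (u R)\<^sup>2)"
proof -
  \<comment> \<open>As \<open>y\<close> decreases, \<open>\<kappa>\<close> bounds
    \<open>sqrt (e - y x)\<close> from below on the whole tail.\<close>
  define \<kappa> where "\<kappa> = sqrt (e - y R)"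
  have \<kappa>: "0 < \<kappa>" using y_less[of R] R by (simp add: \<kappa>_def)
  have vL: "v \<le> y L"
  proof (rule tendsto_lowerbound)
    show "(y \<longlongrightarrow> y L) (at_left L)"
      using DERIV_isCont[OF y_deriv] by (simp add: isCont_def filterlim_at_split)
    show "\<forall>\<^sub>F x in at_left L. v \<le> y x"
      using R above by (intro eventually_at_leftI[of 0]) (auto intro: less_imp_le)
  qed simp
  have "((\<lambda>x. - (sqrt (y x * (y x - z) * (e - y x)) / 4)) has_integral (sqrt (y L - v) - sqrt (y R - v))) {R..L}"
  \<comment> \<open>At \<open>L\<close> the cnoidal profile reaches \<open>v\<close>, where the root
    in \<open>sqrt (y x - v)\<close> is singular; hence the version with derivatives on the open
    interval.\<close>
  proof (rule fundamental_theorem_of_calculus_interior)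
    show "continuous_on {R..L} (\<lambda>x. sqrt (y x - v))"
      by (intro continuous_intros continuous_on_y)
    fix x assume x: "x \<in> {R<..<L}"
    then have yv: "0 < y x - v" using above[of x] R by auto
    have "- y1 x = sqrt ((y1 x)\<^sup>2)" using decreasing[of x] x R by simp
    also have "\<dots> = sqrt (y x * (y x - z) * (e - y x)) * sqrt (y x - v) / 2"
      unfolding energy by (simp add: real_sqrt_divide real_sqrt_mult)
    finally have y1x: "y1 x = - (sqrt (y x * (y x - z) * (e - y x)) * sqrt (y x - v) / 2)" by simp
    have "((\<lambda>x. sqrt (y x - v)) has_real_derivative y1 x * (inverse (sqrt (y x - v)) / 2)) (at x)"
      using yv by (auto intro!: derivative_eq_intros y_deriv)
    also have "y1 x * (inverse (sqrt (y x - v)) / 2) = - (sqrt (y x * (y x - z) * (e - y x)) / 4)"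
      unfolding y1x using yv by (simp add: field_simps)
    finally show "((\<lambda>x. sqrt (y x - v)) has_vector_derivative - (sqrt (y x * (y x - z) * (e - y x)) / 4)) (at x)"
      by (simp add: has_real_derivative_iff_has_vector_derivative)
  qed (use R in auto)
  from has_integral_neg[OF this]
  have I: "((\<lambda>x. sqrt (y x * (y x - z) * (e - y x)) / 4) has_integral (sqrt (y R - v) - sqrt (y L - v))) {R..L}"
    by simp
  have "((\<lambda>x. \<kappa> / 4 * y x) has_integral (\<kappa> / 4 * integral {R..L} y)) {R..L}"
    by (intro has_integral_mult_right integrable_integral integrable_continuous_real continuous_on_y)
  from this I have "\<kappa> / 4 * integral {R..L} y \<le> sqrt (y R - v) - sqrt (y L - v)"
  proof (rule has_integral_le)
    fix x assume x: "x \<in> {R..L}"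
    have "\<kappa> * y x = sqrt (y x * y x * (e - y R))"
      using y_pos[of x] by (simp add: \<kappa>_def real_sqrt_mult)
    also have "\<dots> \<le> sqrt (y x * (y x - z) * (e - y x))"
      using y_pos[of x] z_nonpos y_antimono[of R x] y_le[of R] x R
      by (intro real_sqrt_le_mono mult_mono) auto
    finally show "\<kappa> / 4 * y x \<le> sqrt (y x * (y x - z) * (e - y x)) / 4" by simp
  qed
  also have "\<dots> \<le> u R"
  proof -
    have "sqrt (y R - v) \<le> u R" unfolding u_def using v_nonneg by simp
    moreover have "0 \<le> sqrt (y L - v)" using vL by simp
    ultimately show ?thesis by linarith
  qed
  finally show ?thesis using \<kappa> by (simp add: u_sq \<kappa>_def[symmetric] field_simps)
qed

text \<open>After expanding the cubic, \<open>- y^3\<close> and \<open>z * v * e\<close> are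
  nonpositive and \<open>y^2 <= M * y\<close>. The rest is linear in \<open>y\<close>, so the tail
  mass controls the first derivative.\<close>

lemma u1_sq_le:
  assumes "0 \<le> x" "x \<le> L" "e \<le> M"
  shows "(u1 x)\<^sup>2 \<le> (4 * \<bar>c\<bar> * M + \<bar>16 * \<omega> - 4 * c\<^sup>2\<bar>) / 16 * y x"
proof -
  define D where "D = 16 * \<omega> - 4 * c\<^sup>2"
  have D: "z * v + e * (z + v) = - D" using sigma2 by (simp add: D_def)
  have "16 * (u1 x)\<^sup>2 = - ((y x) ^ 3) + (z + v + e) * (y x)\<^sup>2 - (z * v + e * (z + v)) * y x + z * v * e"
    unfolding u1_sq by (simp add: power2_eq_square power3_eq_cube field_simps)
  also have "\<dots> = - ((y x) ^ 3) + 4 * (c * y x * y x) + D * y x + z * v * e"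
    unfolding sigma1 D by (simp add: power2_eq_square)
  also have "\<dots> \<le> 4 * (\<bar>c\<bar> * M * y x) + \<bar>D\<bar> * y x"
  proof -
    have "c * y x * y x \<le> \<bar>c\<bar> * M * y x"
      using y_pos[of x] y_le[OF assms(1,2)] assms(3) by (intro mult_mono) auto
    moreover have "D * y x \<le> \<bar>D\<bar> * y x" using y_pos[of x] by (intro mult_right_mono) auto
    moreover have "z * v * e \<le> 0" using z_nonpos v_nonneg e_pos by (simp add: mult_nonneg_nonneg mult_nonpos_nonneg)
    moreover have "0 \<le> (y x) ^ 3" using y_pos[of x] by simp
    ultimately show ?thesis by linarith
  qed
  finally show ?thesis by (simp add: D_def algebra_simps)
qed

lemma force_sq_le:
  assumes "0 \<le> x" "x \<le> L" "e \<le> M"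
  shows "(force \<omega> c (u x))\<^sup>2 \<le> (force_lip \<omega> c M)\<^sup>2 * y x"
proof -
  have "u x \<le> sqrt M" unfolding u_def using y_le[OF assms(1,2)] assms(3) by simp
  then have "\<bar>force \<omega> c (u x) - force \<omega> c 0\<bar> \<le> force_lip \<omega> c M * \<bar>u x - 0\<bar>"
    using u_pos[of x] e_pos assms(3) by (intro force_lipschitz) auto
  then have "\<bar>force \<omega> c (u x)\<bar> \<le> force_lip \<omega> c M * u x"
    using u_pos[of x] by (simp add: force_def)
  then have "\<bar>force \<omega> c (u x)\<bar>\<^sup>2 \<le> (force_lip \<omega> c M * u x)\<^sup>2" by (intro power_mono) auto
  then show ?thesis by (simp add: power_mult_distrib u_sq)
qed

lemma u1_0: "u1 0 = 0" using u1_sq[of 0] y_0 by simp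

end

section \<open>Comparison of two profiles\<close>

text \<open>The two profiles share \<open>\<omega>\<close> and \<open>c\<close>, hence their
  equation; the common bound \<open>M\<close> makes the constants below independent of the
  pair.\<close>

locale profile_pair =
  P: wave_profile \<omega> c z v e L y y1 + Q: wave_profile \<omega> c z' v' e' L y' y1'
  for \<omega> c L z v e y y1 z' v' e' y' y1' +
  fixes M :: real
  assumes e_le: "e \<le> M" and e'_le: "e' \<le> M"
begin

abbreviation "K \<equiv> force_lip \<omega> c M"

text \<open>Second derivatives are read off from the equation. Every index above 1 gets the
  second-order value; \<open>deriv_diff\<close> concerns indices up to 2.\<close>

definition diff_deriv :: "nat \<Rightarrow> real \<Rightarrow> real" where
  "diff_deriv j x = (if j = 0 then P.u x - Q.u x else if j = 1 then P.u1 x - Q.u1 x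
     else force \<omega> c (P.u x) - force \<omega> c (Q.u x))"

lemma K_nonneg: "0 \<le> K"
  using P.e_pos e_le by (intro force_lip_nonneg) simp

lemma force_diff:
  assumes "0 \<le> x" "x \<le> L"
  shows "\<bar>force \<omega> c (P.u x) - force \<omega> c (Q.u x)\<bar> \<le> K * \<bar>P.u x - Q.u x\<bar>"
  using P.y_le[OF assms] Q.y_le[OF assms] e_le e'_le P.u_pos[of x] Q.u_pos[of x]
  by (intro force_lipschitz) (auto simp: P.u_def Q.u_def)

text \<open>Gronwall's argument for the energy of the difference of the two profiles.\<close>

lemma initial_value_stability:
  assumes x: "0 \<le> x" "x \<le> L"
  shows "(P.u x - Q.u x)\<^sup>2 + (P.u1 x - Q.u1 x)\<^sup>2 \<le> (sqrt e - sqrt e')\<^sup>2 * exp ((1 + K) * x)"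
proof -
  define w where "w t = (P.u t - Q.u t)\<^sup>2 + (P.u1 t - Q.u1 t)\<^sup>2" for t
  define F where "F t = force \<omega> c (P.u t) - force \<omega> c (Q.u t)" for t
  \<comment> \<open>In the derivative of \<open>w\<close> the term \<open>2 * d * d1\<close> is at
    most \<open>w\<close> and \<open>2 * d1 * F t\<close> at most \<open>K * w\<close>, whence the
    rate \<open>1 + K\<close>.\<close>
  have "w x * exp (- ((1 + K) * x)) \<le> w 0 * exp (- ((1 + K) * 0))"
  proof (rule DERIV_nonpos_imp_nonincreasing[OF x(1)])
    fix t assume t: "0 \<le> t" "t \<le> x"
    define d where "d = P.u t - Q.u t"
    define d1 where "d1 = P.u1 t - Q.u1 t"
    have dw: "(w has_real_derivative 2 * d * d1 + 2 * d1 * F t) (at t)"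
      unfolding w_def[abs_def]
      by (auto intro!: derivative_eq_intros P.u_deriv Q.u_deriv P.u1_deriv Q.u1_deriv
          simp: d_def d1_def F_def algebra_simps)
    have "((\<lambda>t. w t * exp (- ((1 + K) * t))) has_real_derivative
        (2 * d * d1 + 2 * d1 * F t - (1 + K) * w t) * exp (- ((1 + K) * t))) (at t)"
      by (rule derivative_eq_intros dw refl)+ (simp add: algebra_simps)
    moreover have "2 * d * d1 + 2 * d1 * F t - (1 + K) * w t \<le> 0"
    proof -
      have s: "2 * (\<bar>d\<bar> * \<bar>d1\<bar>) \<le> d\<^sup>2 + d1\<^sup>2"
        using sum_squares_bound[of "\<bar>d\<bar>" "\<bar>d1\<bar>"] by simp
      have "d * d1 \<le> \<bar>d\<bar> * \<bar>d1\<bar>" by (metis abs_ge_self abs_mult)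
      moreover have "d1 * F t \<le> \<bar>d1\<bar> * (K * \<bar>d\<bar>)"
      proof -
        have "d1 * F t \<le> \<bar>d1\<bar> * \<bar>F t\<bar>" by (metis abs_ge_self abs_mult)
        also have "\<dots> \<le> \<bar>d1\<bar> * (K * \<bar>d\<bar>)"
          using force_diff[of t] t x by (intro mult_left_mono) (auto simp: F_def d_def)
        finally show ?thesis .
      qed
      moreover have "K * (2 * (\<bar>d\<bar> * \<bar>d1\<bar>)) \<le> K * (d\<^sup>2 + d1\<^sup>2)"
        using s K_nonneg by (rule mult_left_mono)
      moreover have "\<bar>d1\<bar> * (K * \<bar>d\<bar>) = K * (\<bar>d\<bar> * \<bar>d1\<bar>)" by simp
      moreover have "(1 + K) * w t = d\<^sup>2 + d1\<^sup>2 + K * (d\<^sup>2 + d1\<^sup>2)"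
        by (simp add: w_def d_def d1_def distrib_right)
      ultimately show ?thesis using s by linarith
    qed
    ultimately show "\<exists>D. ((\<lambda>t. w t * exp (- ((1 + K) * t))) has_real_derivative D) (at t) \<and> D \<le> 0"
      by (intro exI[of _ "(2 * d * d1 + 2 * d1 * F t - (1 + K) * w t) * exp (- ((1 + K) * t))"])
         (simp add: mult_nonpos_nonneg)
  qed
  moreover have "w 0 = (sqrt e - sqrt e')\<^sup>2"
    by (simp add: w_def P.u_def Q.u_def P.y_0 Q.y_0 P.u1_0 Q.u1_0)
  ultimately have "w x * exp (- ((1 + K) * x)) * exp ((1 + K) * x) \<le> (sqrt e - sqrt e')\<^sup>2 * exp ((1 + K) * x)"
    by (intro mult_right_mono) auto
  then show ?thesis by (simp add: w_def mult.assoc flip: exp_add)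
qed

lemma deriv_diff:
  assumes "j \<le> 2"
  shows "(deriv ^^ j) (\<lambda>x. P.u x - Q.u x) = diff_deriv j"
proof -
  have 1: "deriv (\<lambda>x. P.u x - Q.u x) = (\<lambda>x. P.u1 x - Q.u1 x)"
    by (intro ext DERIV_imp_deriv) (auto intro!: derivative_intros P.u_deriv Q.u_deriv)
  have 2: "deriv (\<lambda>x. P.u1 x - Q.u1 x) = (\<lambda>x. force \<omega> c (P.u x) - force \<omega> c (Q.u x))"
    by (intro ext DERIV_imp_deriv) (auto intro!: derivative_intros P.u1_deriv Q.u1_deriv)
  consider "j = 0" | "j = 1" | "j = 2" using assms by linarith
  then show ?thesis
    by cases (auto simp: diff_deriv_def 1 2 numeral_2_eq_2 fun_eq_iff)
qed

lemma continuous_on_diff_deriv: "continuous_on S (diff_deriv j)"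
proof -
  have "continuous_on S P.u" "continuous_on S Q.u" "continuous_on S P.u1" "continuous_on S Q.u1"
    by (intro continuous_at_imp_continuous_on ballI, rule DERIV_isCont,
        rule P.u_deriv Q.u_deriv P.u1_deriv Q.u1_deriv)+
  then show ?thesis
    unfolding diff_deriv_def[abs_def] force_def
    by (cases "j = 0"; cases "j = 1") (auto intro!: continuous_intros)
qed

lemma diff_deriv_sq_even: "(diff_deriv j (- x))\<^sup>2 = (diff_deriv j x)\<^sup>2"
  using power2_commute[of "P.u1 x" "Q.u1 x"]
  by (simp add: diff_deriv_def P.u_even Q.u_even P.u1_odd Q.u1_odd)

text \<open>The factor \<open>1 + K^2\<close> serves all orders at once: the energy bounds orders 0
  and 1, and the Lipschitz bound on \<open>force\<close> adds \<open>K^2\<close> for order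
  2.\<close>

lemma diff_deriv_sq_le_local:
  assumes "0 \<le> x" "x \<le> R" "R \<le> L"
  shows "(diff_deriv j x)\<^sup>2 \<le> (1 + K\<^sup>2) * ((sqrt e - sqrt e')\<^sup>2 * exp ((1 + K) * R))"
proof -
  define d where "d = P.u x - Q.u x"
  define d1 where "d1 = P.u1 x - Q.u1 x"
  have "d\<^sup>2 + d1\<^sup>2 \<le> (sqrt e - sqrt e')\<^sup>2 * exp ((1 + K) * x)"
    using initial_value_stability[of x] assms by (simp add: d_def d1_def)
  also have "\<dots> \<le> (sqrt e - sqrt e')\<^sup>2 * exp ((1 + K) * R)"
    using assms K_nonneg by (intro mult_left_mono) (auto intro: mult_left_mono)
  finally have w: "d\<^sup>2 + d1\<^sup>2 \<le> (sqrt e - sqrt e')\<^sup>2 * exp ((1 + K) * R)" .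
  have "(diff_deriv j x)\<^sup>2 \<le> (1 + K\<^sup>2) * (d\<^sup>2 + d1\<^sup>2)"
  proof -
    have "\<bar>force \<omega> c (P.u x) - force \<omega> c (Q.u x)\<bar>\<^sup>2 \<le> (K * \<bar>d\<bar>)\<^sup>2"
      using force_diff[of x] assms by (intro power_mono) (auto simp: d_def)
    then have f: "(force \<omega> c (P.u x) - force \<omega> c (Q.u x))\<^sup>2 \<le> K\<^sup>2 * d\<^sup>2"
      by (simp add: power_mult_distrib)
    have e: "(1 + K\<^sup>2) * (d\<^sup>2 + d1\<^sup>2) = d\<^sup>2 + d1\<^sup>2 + K\<^sup>2 * d\<^sup>2 + K\<^sup>2 * d1\<^sup>2"
      by (simp add: algebra_simps)
    have "0 \<le> d\<^sup>2" "0 \<le> d1\<^sup>2" "0 \<le> K\<^sup>2 * d\<^sup>2" "0 \<le> K\<^sup>2 * d1\<^sup>2" by auto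
    then show ?thesis
      unfolding e using f unfolding diff_deriv_def d_def[symmetric] d1_def[symmetric]
      by (auto simp only: split: if_split)
  qed
  also have "\<dots> \<le> (1 + K\<^sup>2) * ((sqrt e - sqrt e')\<^sup>2 * exp ((1 + K) * R))"
    using w by (intro mult_left_mono) auto
  finally show ?thesis .
qed

text \<open>The outer 2 comes from \<open>(p - q)^2 <= 2 * p^2 + 2 * q^2\<close>; the three summands
  bound the squares of \<open>u\<close>, \<open>u''\<close> and \<open>u'\<close>, in this order,
  relative to \<open>y\<close>.\<close>

definition tail_const :: real where
  "tail_const = 2 * (1 + K\<^sup>2 + (4 * \<bar>c\<bar> * M + \<bar>16 * \<omega> - 4 * c\<^sup>2\<bar>) / 16)"

lemma tail_const_nonneg: "0 \<le> tail_const"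
  using P.e_pos e_le by (auto simp: tail_const_def)

text \<open>Far from the crest the Gronwall factor is too large, so the two profiles are estimated
  separately and only their size counts.\<close>

lemma diff_deriv_sq_le_tail:
  assumes x: "0 \<le> x" "x \<le> L"
  shows "(diff_deriv j x)\<^sup>2 \<le> tail_const * (y x + y' x)"
proof -
  define C1 where "C1 = (4 * \<bar>c\<bar> * M + \<bar>16 * \<omega> - 4 * c\<^sup>2\<bar>) / 16"
  have M: "0 \<le> M" using P.e_pos e_le by simp
  then have C1: "0 \<le> C1" by (simp add: C1_def)
  have sq: "(p - q)\<^sup>2 \<le> 2 * (1 + K\<^sup>2 + C1) * (y x + y' x)"
    if p: "p\<^sup>2 \<le> (1 + K\<^sup>2 + C1) * y x" and q: "q\<^sup>2 \<le> (1 + K\<^sup>2 + C1) * y' x" for p q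
  proof -
    have "(p - q)\<^sup>2 \<le> 2 * p\<^sup>2 + 2 * q\<^sup>2"
      using zero_le_power2[of "p + q"] unfolding power2_sum power2_diff by linarith
    also have "\<dots> \<le> 2 * ((1 + K\<^sup>2 + C1) * y x) + 2 * ((1 + K\<^sup>2 + C1) * y' x)" using p q by linarith
    finally show ?thesis by (simp add: algebra_simps)
  qed
  have mono: "a \<le> (1 + K\<^sup>2 + C1) * b" if "a \<le> r * b" "r \<le> 1 + K\<^sup>2 + C1" "0 < b" for a b r :: real
    using that by (meson less_imp_le mult_right_mono order_trans)
  have r: "1 \<le> 1 + K\<^sup>2 + C1" "K\<^sup>2 \<le> 1 + K\<^sup>2 + C1" "C1 \<le> 1 + K\<^sup>2 + C1"
    using C1 zero_le_power2[of K] by linarith+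
  have "(P.u x)\<^sup>2 \<le> (1 + K\<^sup>2 + C1) * y x" "(Q.u x)\<^sup>2 \<le> (1 + K\<^sup>2 + C1) * y' x"
    using mono[OF _ r(1) P.y_pos] mono[OF _ r(1) Q.y_pos] by (simp_all add: P.u_sq Q.u_sq)
  moreover have "(P.u1 x)\<^sup>2 \<le> (1 + K\<^sup>2 + C1) * y x" "(Q.u1 x)\<^sup>2 \<le> (1 + K\<^sup>2 + C1) * y' x"
    using mono[OF P.u1_sq_le[OF x e_le, folded C1_def] r(3) P.y_pos]
      mono[OF Q.u1_sq_le[OF x e'_le, folded C1_def] r(3) Q.y_pos] .
  moreover have "(force \<omega> c (P.u x))\<^sup>2 \<le> (1 + K\<^sup>2 + C1) * y x" "(force \<omega> c (Q.u x))\<^sup>2 \<le> (1 + K\<^sup>2 + C1) * y' x"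
    using mono[OF P.force_sq_le[OF x e_le] r(2) P.y_pos] mono[OF Q.force_sq_le[OF x e'_le] r(2) Q.y_pos] .
  ultimately show ?thesis
    unfolding tail_const_def diff_deriv_def C1_def[symmetric] using sq by simp
qed

text \<open>Evenness reduces the integral to \<open>[0, L]\<close>, which is cut at
  \<open>R\<close>: stability from the crest on the left part, the tail masses of both profiles on
  the right part.\<close>

lemma integral_diff_deriv_sq_le:
  assumes R: "0 < R" "R \<le> L" and j: "j \<le> 2"
  shows "integral {-L..L} (\<lambda>x. ((deriv ^^ j) (\<lambda>x. P.u x - Q.u x) x)\<^sup>2)
    \<le> 2 * (R * ((1 + K\<^sup>2) * ((sqrt e - sqrt e')\<^sup>2 * exp ((1 + K) * R)))
      + tail_const * (4 * P.u R / sqrt (e - (P.u R)\<^sup>2) + 4 * Q.u R / sqrt (e' - (Q.u R)\<^sup>2)))"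
proof -
  define h where "h x = (diff_deriv j x)\<^sup>2" for x
  have int: "h integrable_on {a..b}" for a b
    unfolding h_def by (intro integrable_continuous_real continuous_intros continuous_on_diff_deriv)
  have "(\<lambda>x. h (- x)) = h" by (simp add: h_def[abs_def] diff_deriv_sq_even)
  then have "integral {-L..0} h = integral {0..L} h"
    using Henstock_Kurzweil_Integration.integral_reflect_real[of L 0 h] by simp
  moreover have "integral {-L..0} h + integral {0..L} h = integral {-L..L} h"
    using R int by (intro Henstock_Kurzweil_Integration.integral_combine) auto
  moreover have "integral {0..R} h + integral {R..L} h = integral {0..L} h"
    using R int by (intro Henstock_Kurzweil_Integration.integral_combine) auto
  moreover have "integral {0..R} h \<le> R * ((1 + K\<^sup>2) * ((sqrt e - sqrt e')\<^sup>2 * exp ((1 + K) * R)))"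
  proof -
    have "integral {0..R} h \<le> integral {0..R} (\<lambda>x. (1 + K\<^sup>2) * ((sqrt e - sqrt e')\<^sup>2 * exp ((1 + K) * R)))"
      using int R diff_deriv_sq_le_local by (intro integral_le) (auto simp: h_def)
    then show ?thesis using R by (simp add: mult_ac)
  qed
  moreover have "integral {R..L} h \<le> tail_const * (4 * P.u R / sqrt (e - (P.u R)\<^sup>2) + 4 * Q.u R / sqrt (e' - (Q.u R)\<^sup>2))"
  proof -
    have yi: "y integrable_on {R..L}" "y' integrable_on {R..L}"
      by (intro integrable_continuous_real P.continuous_on_y Q.continuous_on_y)+
    have "integral {R..L} h \<le> integral {R..L} (\<lambda>x. tail_const * (y x + y' x))"
      using int R diff_deriv_sq_le_tail yi
      by (intro integral_le integrable_on_mult_right integrable_add) (auto simp: h_def)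
    also have "\<dots> = tail_const * (integral {R..L} y + integral {R..L} y')"
      using yi by (simp add: Henstock_Kurzweil_Integration.integral_add)
    also have "\<dots> \<le> tail_const * (4 * P.u R / sqrt (e - (P.u R)\<^sup>2) + 4 * Q.u R / sqrt (e' - (Q.u R)\<^sup>2))"
      using P.tail_mass[OF R] Q.tail_mass[OF R] tail_const_nonneg by (intro mult_left_mono add_mono)
    finally show ?thesis .
  qed
  ultimately have *: "integral {-L..L} h = 2 * (integral {0..R} h + integral {R..L} h)"
    "integral {0..R} h + integral {R..L} h \<le> R * ((1 + K\<^sup>2) * ((sqrt e - sqrt e')\<^sup>2 * exp ((1 + K) * R)))
      + tail_const * (4 * P.u R / sqrt (e - (P.u R)\<^sup>2) + 4 * Q.u R / sqrt (e' - (Q.u R)\<^sup>2))"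
    by - (metis mult_2, rule add_mono)
  from mult_left_mono[OF *(2), of 2] have "integral {-L..L} h
    \<le> 2 * (R * ((1 + K\<^sup>2) * ((sqrt e - sqrt e')\<^sup>2 * exp ((1 + K) * R)))
      + tail_const * (4 * P.u R / sqrt (e - (P.u R)\<^sup>2) + 4 * Q.u R / sqrt (e' - (Q.u R)\<^sup>2)))"
    by (simp only: *(1) zero_le_numeral simp_thms)
  then show ?thesis by (simp only: deriv_diff[OF j] h_def[abs_def])
qed

end

text \<open>A profile for every \<open>L\<close> decreases on the whole half-line, with mass beyond
  1 at most \<open>B\<close>. Hence \<open>(x - 1) * y x <= B\<close>, a decay that covers the
  exponential and the algebraic soliton alike.\<close>

lemma wave_profile_tail_small:
  assumes wp: "\<And>L. wave_profile \<omega> c z v e L y y1" and "0 < \<epsilon>"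
  shows "\<exists>R>0. 4 * sqrt (y R) / sqrt (e - y R) < \<epsilon>"
proof -
  define B where "B = 4 * sqrt (y 1) / sqrt (e - y 1)"
  have u: "wave_profile.u y x = sqrt (y x)" "(sqrt (y x))\<^sup>2 = y x" for x
    using wave_profile.u_def[OF wp] wave_profile.u_sq[OF wp, of x] by auto
  have "y x \<le> B / (x - 1)" if "1 < x" for x
  proof -
    interpret wave_profile \<omega> c z v e x y y1 by (rule wp)
    have "integral {1..x} (\<lambda>t. y x) \<le> integral {1..x} y"
      using that y_antimono[of _ x]
      by (intro integral_le integrable_const_ivl integrable_continuous_real continuous_on_y) auto
    also have "\<dots> \<le> B" using tail_mass[of 1] that by (simp add: u B_def)
    finally show ?thesis using that by (simp add: field_simps)
  qed
  then have le: "\<forall>\<^sub>F x in at_top. y x \<le> B / (x - 1)"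
    by (rule eventually_mono[OF eventually_gt_at_top[of 1]])
  have "filterlim (\<lambda>x. - 1 + x) at_top (at_top :: real filter)"
    by (intro filterlim_tendsto_add_at_top[OF tendsto_const] filterlim_ident)
  then have "((\<lambda>x. B / (x - 1)) \<longlongrightarrow> 0) (at_top :: real filter)"
    by (intro real_tendsto_divide_at_top[OF tendsto_const]) (simp add: add.commute)
  then have y0: "(y \<longlongrightarrow> 0) at_top"
    using wave_profile.y_pos[OF wp]
    by (intro real_tendsto_sandwich[OF _ le tendsto_const]) (auto intro!: always_eventually less_imp_le)
  have "0 < e" using wave_profile.e_pos[OF wp] .
  then have "((\<lambda>x. 4 * sqrt (y x) / sqrt (e - y x)) \<longlongrightarrow> 4 * sqrt 0 / sqrt (e - 0)) at_top"
    by (intro tendsto_intros y0) auto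
  then have "\<forall>\<^sub>F x in at_top. 4 * sqrt (y x) / sqrt (e - y x) < \<epsilon>"
    using \<open>0 < \<epsilon>\<close> by (intro order_tendstoD) auto
  then have "\<forall>\<^sub>F x in at_top. 0 < x \<and> 4 * sqrt (y x) / sqrt (e - y x) < \<epsilon>"
    using eventually_gt_at_top[of 0] by eventually_elim auto
  then show ?thesis using eventually_happens'[OF trivial_limit_at_top_linorder] by fastforce
qed

section \<open>The soliton and the limit\<close>

text \<open>For \<open>y = N / q\<close> and \<open>v = 0\<close> the quartic law becomes the
  quadratic law \<open>q1_sq\<close>. Differentiating it and dividing by \<open>q1\<close> suggests
  \<open>q2_eq\<close>, which is assumed separately because \<open>q1\<close> vanishes at 0.\<close>

lemma wave_profile_quotient:
  fixes \<omega> c z e N L :: real and q q1 q2 :: "real \<Rightarrow> real"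
  assumes q_pos: "\<And>x. 0 < q x" and q_even: "\<And>x. q (- x) = q x"
    and q_deriv: "\<And>x. (q has_real_derivative q1 x) (at x)"
    and q1_deriv: "\<And>x. (q1 has_real_derivative q2 x) (at x)"
    and q1_sq: "\<And>x. 4 * (q1 x)\<^sup>2 = (N - z * q x) * (e * q x - N)"
    and q2_eq: "\<And>x. 8 * q2 x = N * (e + z) - 2 * z * e * q x"
    and q_0: "e * q 0 = N" and q1_pos: "\<And>x. 0 < x \<Longrightarrow> 0 < q1 x"
    and "0 < N" "z \<le> 0" "z + e = 4 * c" "z * e = 4 * c\<^sup>2 - 16 * \<omega>"
  shows "wave_profile \<omega> c z 0 e L (\<lambda>x. N / q x) (\<lambda>x. - N * q1 x / (q x)\<^sup>2)"
proof
  fix x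
  have q: "q x \<noteq> 0" using q_pos[of x] by simp
  show "0 < N / q x" using q_pos \<open>0 < N\<close> by simp
  show "N / q (- x) = N / q x" by (simp add: q_even)
  show "((\<lambda>x. N / q x) has_real_derivative - N * q1 x / (q x)\<^sup>2) (at x)"
    using q by (auto intro!: derivative_eq_intros q_deriv simp: power2_eq_square)
  define Y where "Y = 1 / q x"
  have Y: "Y * q x = 1" "N / q x = N * Y" using q by (simp_all add: Y_def)
  show "(- N * q1 x / (q x)\<^sup>2)\<^sup>2 = N / q x * (N / q x - z) * (N / q x - 0) * (e - N / q x) / 4"
  proof -
    have "4 * (- N * q1 x / (q x)\<^sup>2)\<^sup>2 = (N * Y)\<^sup>2 * (4 * (q1 x)\<^sup>2) * Y\<^sup>2"
      by (simp add: Y_def power_divide power_mult_distrib)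
    also have "\<dots> = (N * Y)\<^sup>2 * ((N - z * q x) * Y * ((e * q x - N) * Y))"
      unfolding q1_sq by (simp add: power2_eq_square)
    also have "(N - z * q x) * Y = N * Y - z"
      using Y(1) by (simp add: algebra_simps)
    also have "(e * q x - N) * Y = e - N * Y"
      using Y(1) by (simp add: algebra_simps)
    finally have "4 * (- N * q1 x / (q x)\<^sup>2)\<^sup>2 = N / q x * (N / q x - z) * (N / q x - 0) * (e - N / q x)"
      unfolding Y(2) power2_eq_square[of "N * Y"] by (simp only: diff_zero mult_ac)
    moreover have "4 * a = r \<Longrightarrow> a = r / 4" for a r :: real by simp
    ultimately show ?thesis by blast
  qed
  have "((\<lambda>x. - N * q1 x / (q x)\<^sup>2) has_real_derivative
      (- N * q2 x * (q x)\<^sup>2 - - N * q1 x * (2 * q x * q1 x)) / ((q x)\<^sup>2 * (q x)\<^sup>2)) (at x)"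
  proof (rule DERIV_divide)
    show "((\<lambda>x. - N * q1 x) has_real_derivative - N * q2 x) (at x)"
      by (intro DERIV_cmult q1_deriv)
    show "((\<lambda>x. (q x)\<^sup>2) has_real_derivative 2 * q x * q1 x) (at x)"
      by (auto intro!: derivative_eq_intros q_deriv)
  qed (use q in simp)
  also have "(- N * q2 x * (q x)\<^sup>2 - - N * q1 x * (2 * q x * q1 x)) / ((q x)\<^sup>2 * (q x)\<^sup>2)
    = N * Y ^ 3 / 8 * (4 * (4 * (q1 x)\<^sup>2) - q x * (8 * q2 x))"
    using q by (simp add: Y_def field_simps power2_eq_square power3_eq_cube)
  also have "\<dots> = N * Y ^ 3 / 8 * (4 * ((N - z * q x) * (e * q x - N)) - q x * (N * (e + z) - 2 * z * e * q x))"
    unfolding q1_sq q2_eq ..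
  also have "\<dots> = N * Y ^ 3 / 8 * (2 * ((N - z * q x) * (e * q x - N)) + N * (e * q x - N) - N * (N - z * q x))"
    by (simp add: algebra_simps)
  also have "\<dots> = N / 8 * (2 * (((N - z * q x) * Y) * ((e * q x - N) * Y) * Y)
      + N * Y * Y * ((e * q x - N) * Y) - N * Y * Y * ((N - z * q x) * Y))"
    by (simp add: power3_eq_cube algebra_simps)
  also have "(N - z * q x) * Y = N * Y - z"
    using Y(1) by (simp add: algebra_simps)
  also have "(e * q x - N) * Y = e - N * Y"
    using Y(1) by (simp add: algebra_simps)
  also have "N / 8 * (2 * ((N * Y - z) * (e - N * Y) * Y) + N * Y * Y * (e - N * Y) - N * Y * Y * (N * Y - z))
    = ((N / q x - z) * (N / q x - 0) * (e - N / q x) + N / q x * (N / q x - 0) * (e - N / q x)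
        + N / q x * (N / q x - z) * (e - N / q x) - N / q x * (N / q x - z) * (N / q x - 0)) / 8"
    unfolding Y(2) by (simp add: algebra_simps)
  finally show "((\<lambda>x. - N * q1 x / (q x)\<^sup>2) has_real_derivative
      ((N / q x - z) * (N / q x - 0) * (e - N / q x) + N / q x * (N / q x - 0) * (e - N / q x)
        + N / q x * (N / q x - z) * (e - N / q x) - N / q x * (N / q x - z) * (N / q x - 0)) / 8) (at x)" .
next
  show "N / q 0 = e" using q_0 q_pos[of 0] by (simp add: field_simps)
  fix x :: real assume "0 < x"
  then have "0 < N * q1 x / (q x)\<^sup>2" using q1_pos[of x] q_pos[of x] \<open>0 < N\<close> by simp
  then show "- N * q1 x / (q x)\<^sup>2 < 0" by simp
  show "0 < N / q x" using q_pos \<open>0 < N\<close> by simp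
qed (use assms in \<open>auto simp: mult.commute\<close>)

section \<open>The exponential and the algebraic soliton\<close>

context admissible
begin

text \<open>The roots are those of the periodic family at \<open>e = alpha1\<close>, where
  \<open>v = 0\<close>. If \<open>4 * \<omega> = c^2\<close>, then \<open>z\<close> vanishes too and
  a quadratic polynomial replaces the hyperbolic cosine.\<close>

lemma soliton_profile:
  "\<exists>y y1. Phi \<omega> c = (\<lambda>x. sqrt (y x)) \<and> (\<forall>L. wave_profile \<omega> c (2 * c - 4 * sqrt \<omega>) 0 (alpha1 \<omega> c) L y y1)"
proof (cases "\<omega> > c\<^sup>2 / 4")
  case True
  define \<kappa> where "\<kappa> = sqrt (4 * \<omega> - c\<^sup>2)"
  have \<kappa>: "0 < \<kappa>" "\<kappa>\<^sup>2 = 4 * \<omega> - c\<^sup>2" using True by (auto simp: \<kappa>_def)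
  define s where "s = sqrt \<omega>"
  have s: "0 < s" "s\<^sup>2 = \<omega>" using sqrt_omega by (auto simp: s_def)
  have k2: "\<kappa>\<^sup>2 = (2 * s - c) * (2 * s + c)" using \<kappa>(2) s(2) by (simp add: algebra_simps power2_eq_square)
  have cs: "c < 2 * s"
  proof -
    have "0 < (2 * s - c) * (2 * s + c)" using \<kappa>(1) k2 by (metis zero_less_power)
    then show ?thesis using c_gt by (simp add: s_def zero_less_mult_iff)
  qed
  \<comment> \<open>The denominator in \<open>Phi\<close> with \<open>sqrt \<omega>\<close>
    multiplied in.\<close>
  define q where "q x = s * cosh (\<kappa> * x) - c / 2" for x
  have "wave_profile \<omega> c (2 * c - 4 * s) 0 (alpha1 \<omega> c) L (\<lambda>x. \<kappa>\<^sup>2 / q x)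
      (\<lambda>x. - \<kappa>\<^sup>2 * (s * \<kappa> * sinh (\<kappa> * x)) / (q x)\<^sup>2)" for L
  proof (rule wave_profile_quotient[where ?q2.0 = "\<lambda>x. s * \<kappa>\<^sup>2 * cosh (\<kappa> * x)"])
    fix x
    have "s * 1 \<le> s * cosh (\<kappa> * x)" using s(1) cosh_real_ge_1 by (intro mult_left_mono) auto
    then show "0 < q x" using cs by (simp add: q_def)
    show "(q has_real_derivative s * \<kappa> * sinh (\<kappa> * x)) (at x)"
      unfolding q_def[abs_def] by (auto intro!: derivative_eq_intros)
    show "((\<lambda>x. s * \<kappa> * sinh (\<kappa> * x)) has_real_derivative s * \<kappa>\<^sup>2 * cosh (\<kappa> * x)) (at x)"
      by (auto intro!: derivative_eq_intros simp: power2_eq_square)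
    have c: "s * cosh (\<kappa> * x) = q x + c / 2" by (simp add: q_def)
    have "4 * (s * \<kappa> * sinh (\<kappa> * x))\<^sup>2 = 4 * \<kappa>\<^sup>2 * ((s * cosh (\<kappa> * x))\<^sup>2 - s\<^sup>2)"
      by (simp add: power_mult_distrib sinh_square_eq algebra_simps)
    also have "\<dots> = 4 * \<kappa>\<^sup>2 * ((q x + c / 2)\<^sup>2 - s\<^sup>2)" unfolding c ..
    also have "\<dots> = (\<kappa>\<^sup>2 - (2 * c - 4 * s) * q x) * (alpha1 \<omega> c * q x - \<kappa>\<^sup>2)"
      unfolding alpha1_def s_def[symmetric] k2 by (simp add: algebra_simps power2_eq_square)
    finally show "4 * (s * \<kappa> * sinh (\<kappa> * x))\<^sup>2 = (\<kappa>\<^sup>2 - (2 * c - 4 * s) * q x) * (alpha1 \<omega> c * q x - \<kappa>\<^sup>2)" .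
    have "8 * (s * \<kappa>\<^sup>2 * cosh (\<kappa> * x)) = 8 * \<kappa>\<^sup>2 * (q x + c / 2)" by (simp flip: c)
    also have "\<dots> = \<kappa>\<^sup>2 * (alpha1 \<omega> c + (2 * c - 4 * s)) - 2 * (2 * c - 4 * s) * alpha1 \<omega> c * q x"
      unfolding alpha1_def s_def[symmetric] k2 by (simp add: algebra_simps power2_eq_square)
    finally show "8 * (s * \<kappa>\<^sup>2 * cosh (\<kappa> * x))
      = \<kappa>\<^sup>2 * (alpha1 \<omega> c + (2 * c - 4 * s)) - 2 * (2 * c - 4 * s) * alpha1 \<omega> c * q x" .
  next
    show "0 < \<kappa>\<^sup>2" using \<kappa>(1) by simp
    show "alpha1 \<omega> c * q 0 = \<kappa>\<^sup>2"
      unfolding alpha1_def s_def[symmetric] k2 by (simp add: q_def algebra_simps)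
    show "0 < s * \<kappa> * sinh (\<kappa> * x)" if "0 < x" for x using that s \<kappa> by simp
    show "(2 * c - 4 * s) * alpha1 \<omega> c = 4 * c\<^sup>2 - 16 * \<omega>"
      unfolding alpha1_def s_def[symmetric] using s(2) by (simp add: algebra_simps power2_eq_square)
  qed (use \<kappa> cs in \<open>auto simp: q_def alpha1_def s_def\<close>)
  moreover have "Phi \<omega> c = (\<lambda>x. sqrt (\<kappa>\<^sup>2 / q x))"
  proof
    fix x
    have "s * (cosh (\<kappa> * x) - c / (2 * s)) = q x" using s(1) by (simp add: q_def right_diff_distrib)
    then show "Phi \<omega> c x = sqrt (\<kappa>\<^sup>2 / q x)"
      using True by (simp add: Phi_def \<kappa>(2) flip: s_def \<kappa>_def)
  qed
  ultimately show ?thesis unfolding s_def by (intro exI conjI allI)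
next
  case False
  then have w: "4 * \<omega> = c\<^sup>2" using disc by simp
  have s: "sqrt \<omega> = \<bar>c\<bar> / 2"
    by (rule real_sqrt_unique) (use w in \<open>auto simp: power_divide\<close>)
  have c: "0 < c" using c_gt unfolding s by linarith
  have a: "alpha1 \<omega> c = 4 * c" "2 * c - 4 * sqrt \<omega> = 0" using c by (auto simp: alpha1_def s)
  define q where "q x = (c * x)\<^sup>2 + 1" for x
  have "wave_profile \<omega> c 0 0 (4 * c) L (\<lambda>x. 4 * c / q x) (\<lambda>x. - (4 * c) * (2 * c\<^sup>2 * x) / (q x)\<^sup>2)" for L
  proof (rule wave_profile_quotient[where ?q2.0 = "\<lambda>x. 2 * c\<^sup>2"])
    fix x
    show "0 < q x" by (simp add: q_def add_nonneg_pos)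
    show "(q has_real_derivative 2 * c\<^sup>2 * x) (at x)"
      unfolding q_def[abs_def] by (auto intro!: derivative_eq_intros simp: power2_eq_square)
    show "((\<lambda>x. 2 * c\<^sup>2 * x) has_real_derivative 2 * c\<^sup>2) (at x)"
      by (auto intro!: derivative_eq_intros)
    show "4 * (2 * c\<^sup>2 * x)\<^sup>2 = (4 * c - 0 * q x) * (4 * c * q x - 4 * c)"
      by (simp add: q_def power2_eq_square algebra_simps)
    show "8 * (2 * c\<^sup>2) = 4 * c * (4 * c + 0) - 2 * 0 * (4 * c) * q x"
      by (simp add: power2_eq_square)
  qed (use c w in \<open>auto simp: q_def\<close>)
  moreover have "Phi \<omega> c = (\<lambda>x. sqrt (4 * c / q x))"
    using False by (simp add: Phi_def q_def fun_eq_iff)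
  ultimately show ?thesis unfolding a by (intro exI conjI allI)
qed

end

section \<open>Passage to the limit: first the cut-off, then the half-period\<close>

theorem theorem4p2:
  fixes \<omega> c :: real and m :: nat
  assumes "\<omega> > c^2/4 \<or> (\<omega> = c^2/4 \<and> c > 0)"
    and "m \<le> 2"
  shows "((\<lambda>L. Hm_norm m L (\<lambda>x. PhiL \<omega> c L x - Phi \<omega> c x)) \<longlongrightarrow> 0) at_top"
proof -
  interpret admissible \<omega> c
  proof
    show "c\<^sup>2 \<le> 4 * \<omega>" using assms(1) by auto
    have "(c / 2)\<^sup>2 \<le> \<omega>" using assms(1) by (auto simp: power_divide)
    then have "\<bar>c\<bar> / 2 \<le> sqrt \<omega>" using real_sqrt_le_mono by fastforce
    \<comment> \<open>When \<open>\<bar>c\<bar> / 2 = sqrt \<omega>\<close>, the hypothesis leaves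
      only \<open>c > 0\<close>; this is what makes \<open>alpha1\<close> positive.\<close>
    moreover have "\<bar>c\<bar> / 2 < sqrt \<omega> \<or> 0 < c"
      using assms(1)
    proof
      assume "c\<^sup>2 / 4 < \<omega>"
      then have "sqrt ((c / 2)\<^sup>2) < sqrt \<omega>" by (intro real_sqrt_less_mono) (simp add: power_divide)
      then show ?thesis by simp
    qed simp
    ultimately show "0 < alpha1 \<omega> c" by (auto simp: alpha1_def)
  qed
  define M where "M = alpha1 \<omega> c"
  define K where "K = force_lip \<omega> c M"
  \<comment> \<open>\<open>tail_const\<close> depends on \<open>\<omega>\<close>, \<open>c\<close>
    and \<open>M\<close> only, so this constant is fixed before \<open>L\<close>.\<close>
  define C where "C = profile_pair.tail_const \<omega> c M"
  define E where "E L = eta3L \<omega> c L" for L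
  obtain y y1 where Phi: "Phi \<omega> c = (\<lambda>x. sqrt (y x))"
    and wp: "\<And>L. wave_profile \<omega> c (2 * c - 4 * sqrt \<omega>) 0 M L y y1"
    using soliton_profile unfolding M_def by blast
  define J where "J j L = integral {-L..L} (\<lambda>x. ((deriv ^^ j) (\<lambda>x. PhiL \<omega> c L x - Phi \<omega> c x) x)\<^sup>2)" for j L
  define \<Delta> where "\<Delta> R L = (sqrt (E L) - sqrt M)\<^sup>2 * exp ((1 + K) * R)" for R L
  define \<beta> where "\<beta> R = 4 * sqrt (y R) / sqrt (M - y R)" for R
  define \<beta>L where "\<beta>L R L = 4 * PhiL \<omega> c L R / sqrt (E L - (PhiL \<omega> c L R)\<^sup>2)" for R L
  have Elim: "(E \<longlongrightarrow> M) at_top" unfolding E_def M_def using eta3L_tendsto .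
  have estimates: "\<forall>\<^sub>F L in at_top. (PhiL \<omega> c L R - sqrt (y R))\<^sup>2 \<le> \<Delta> R L \<and> 0 \<le> C \<and>
      (\<forall>j\<le>2. J j L \<le> 2 * (R * ((1 + K\<^sup>2) * \<Delta> R L) + C * (\<beta>L R L + \<beta> R)))" if R: "0 < R" for R
    using eventually_eta3L_gt[OF alpha0_less_alpha1] eventually_ge_at_top[of R]
  proof eventually_elim
    case (elim L)
    interpret cn: cnoidal \<omega> c "E L" using elim by unfold_locales (auto simp: E_def)
    interpret pair: profile_pair \<omega> c L cn.z cn.v "E L" cn.prof cn.prof1 "2 * c - 4 * sqrt \<omega>" 0 M y y1 M
      using cn.wave_profile_prof[of L] wp[of L] elim cn.e_less
      by (intro profile_pair.intro profile_pair_axioms.intro) (auto simp: E_def M_def)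
    have P: "PhiL \<omega> c L = pair.P.u"
    proof
      fix x
      have "PhiL \<omega> c L x = sqrt (cn.prof x)" using PhiL_eq_sqrt_prof[of L] elim by (simp add: E_def)
      also have "\<dots> = pair.P.u x" by (rule pair.P.u_def[symmetric])
      finally show "PhiL \<omega> c L x = pair.P.u x" .
    qed
    have Q: "pair.Q.u = (\<lambda>x. sqrt (y x))" by (simp add: fun_eq_iff pair.Q.u_def)
    have "(PhiL \<omega> c L R - sqrt (y R))\<^sup>2 \<le> \<Delta> R L"
      using pair.initial_value_stability[of R] R elim zero_le_power2[of "pair.P.u1 R - pair.Q.u1 R"]
      unfolding P Q \<Delta>_def K_def by linarith
    moreover have "J j L \<le> 2 * (R * ((1 + K\<^sup>2) * \<Delta> R L) + C * (\<beta>L R L + \<beta> R))" if "j \<le> 2" for j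
      using pair.integral_diff_deriv_sq_le[OF R _ that] elim pair.Q.y_pos[of R]
      by (simp add: J_def P Phi Q \<Delta>_def K_def C_def \<beta>_def \<beta>L_def less_imp_le)
    ultimately show ?case using pair.tail_const_nonneg by (simp add: C_def)
  qed
  have J0: "(J j \<longlongrightarrow> 0) at_top" if "j \<le> 2" for j
  proof (rule order_tendstoI)
    fix a :: real assume "a < 0"
    \<comment> \<open>For a non-integrable integrand the integral is 0 by convention, so
      nonnegativity holds for every \<open>L\<close>, even where \<open>eta3L\<close> is not
      characterized.\<close>
    moreover have "0 \<le> J j L" for L unfolding J_def
      by (metis (no_types, lifting) Henstock_Kurzweil_Integration.integral_nonneg not_integrable_integral order_refl zero_le_power2)
    ultimately show "\<forall>\<^sub>F L in at_top. a < J j L" by (simp add: less_le_trans)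
  next
    fix a :: real assume a: "0 < a"
    have C: "0 \<le> C"
      using eventually_happens'[OF trivial_limit_at_top_linorder estimates[of 1]] by auto
    \<comment> \<open>For fixed \<open>R\<close> the bound tends to
      \<open>4 * C * \<beta> R\<close>, which is below \<open>a\<close> once
      \<open>\<beta> R < \<epsilon>\<close>; the summand 1 keeps the denominator positive and the
      inequality strict.\<close>
    define \<epsilon> where "\<epsilon> = a / (4 * C + 1)"
    have \<epsilon>: "0 < \<epsilon>" using a C by (simp add: \<epsilon>_def)
    obtain R where R: "0 < R" "\<beta> R < \<epsilon>"
      using wave_profile_tail_small[OF wp \<epsilon>] unfolding \<beta>_def by blast
    interpret S: wave_profile \<omega> c "2 * c - 4 * sqrt \<omega>" 0 M R y y1 by (rule wp)
    have yR: "0 < y R" "y R < M" using S.y_pos S.y_less[of R] R by auto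
    have \<Delta>0: "(\<Delta> R \<longlongrightarrow> 0) at_top"
    proof -
      have "(\<Delta> R \<longlongrightarrow> (sqrt M - sqrt M)\<^sup>2 * exp ((1 + K) * R)) at_top"
        unfolding \<Delta>_def[abs_def] by (intro tendsto_intros Elim)
      then show ?thesis by simp
    qed
    \<comment> \<open>Convergence at the single point \<open>R\<close> transfers the small tail
      bound from the soliton to the periodic waves.\<close>
    have "((\<lambda>L. PhiL \<omega> c L R - sqrt (y R)) \<longlongrightarrow> 0) at_top"
    proof (rule Lim_null_comparison)
      show "\<forall>\<^sub>F L in at_top. norm (PhiL \<omega> c L R - sqrt (y R)) \<le> sqrt (\<Delta> R L)"
        using estimates[OF R(1)] by eventually_elim (simp add: real_le_rsqrt)
      show "((\<lambda>L. sqrt (\<Delta> R L)) \<longlongrightarrow> 0) at_top" using tendsto_real_sqrt[OF \<Delta>0] by simp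
    qed
    then have PR: "((\<lambda>L. PhiL \<omega> c L R) \<longlongrightarrow> sqrt (y R)) at_top" by (simp add: LIM_zero_iff)
    have "((\<lambda>L. \<beta>L R L) \<longlongrightarrow> 4 * sqrt (y R) / sqrt (M - (sqrt (y R))\<^sup>2)) at_top"
      unfolding \<beta>L_def using yR by (intro tendsto_intros PR Elim) auto
    then have \<beta>lim: "(\<beta>L R \<longlongrightarrow> \<beta> R) at_top" using yR by (simp add: \<beta>_def)
    have "((\<lambda>L. 2 * (R * ((1 + K\<^sup>2) * \<Delta> R L) + C * (\<beta>L R L + \<beta> R)))
        \<longlongrightarrow> 2 * (R * ((1 + K\<^sup>2) * 0) + C * (\<beta> R + \<beta> R))) at_top"
      by (intro tendsto_intros \<Delta>0 \<beta>lim)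
    moreover have "2 * (R * ((1 + K\<^sup>2) * 0) + C * (\<beta> R + \<beta> R)) < a"
    proof -
      have "4 * C * \<beta> R \<le> 4 * C * \<epsilon>" using R(2) C by (intro mult_left_mono) auto
      also have "\<dots> < a" using a C by (simp add: \<epsilon>_def field_simps)
      finally show ?thesis by simp
    qed
    ultimately have "\<forall>\<^sub>F L in at_top. 2 * (R * ((1 + K\<^sup>2) * \<Delta> R L) + C * (\<beta>L R L + \<beta> R)) < a"
      by (rule order_tendstoD)
    with estimates[OF R(1)] show "\<forall>\<^sub>F L in at_top. J j L < a"
      by eventually_elim (use that in force)
  qed
  have "((\<lambda>L. sqrt (\<Sum>j\<le>m. J j L)) \<longlongrightarrow> sqrt (\<Sum>j\<le>m. 0)) at_top"
    using assms(2) by (intro tendsto_intros J0) auto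
  then show ?thesis by (simp add: Hm_norm_def J_def)
qed

end
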